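(* Let $\lambda,\mu\in\Lambda$. The space $\mathrm{Ext}^1_{\mathcal D}(\mathbf S_\lambda,\mathbf S_\mu)$ is one-dimensional if there is a basic morphism $\lambda\to\mu$ in $\mathfrak D$, and vanishes otherwise. A basic morphism $\lambda\to\mu$ exists in exactly the following cases: (a) $\mu=\lambda\bullet\circ$; (b) $\lambda=\mu\circ\bullet$; (c) $\mu=\lambda\circ$ and $\lambda$ does not end in $\bullet$; (d) $\lambda=\mu\bullet$ and $\mu$ does not end in $\circ$.
   Context: Fix a field $k$. A weight is a finite (possibly empty) word in the letters $\bullet,\circ$; $\Lambda$ is the set of weights and $\varnothing$ the empty weight. A weight is alternating if it contains neither $\bullet\bullet$ nor $\circ\circ$ as a substring; $\Lambda^{\mathrm{alt}}_\bullet,\Lambda^{\mathrm{alt}}_\circ$ are the sets of non-empty alternating weights ending in $\bullet$, $\circ$. $\mathfrak D$ is the $k$-linear category with object set $\Lambda$, where $\mathrm{Hom}_{\mathfrak D}(\lambda,\mu)$ is one-dimensional with a distinguished basis vector if $\lambda=\mu$, or $\mu\in\lambda\Lambda^{\mathrm{alt}}_\circ$, or $\lambda\in\mu\Lambda^{\mathrm{alt}}_\bullet$, and is zero otherwise; the composition of distinguished morphisms $\lambda\to\mu\to\nu$ is the distinguished morphism $\lambda\to\nu$ if it exists and zero otherwise. $\mathcal D$ is the category of $k$-linear functors $M$ from $\mathfrak D$ to vector spaces with $\bigoplus_\lambda M(\lambda)$ finite dimensional; $\mathbf S_\lambda$ is the simple object that is $k$ at $\lambda$ and $0$ elsewhere.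 The basic morphisms of $\mathfrak D$ are the distinguished morphisms $\lambda\circ\bullet\to\lambda$, $\lambda\bullet\bullet\to\lambda\bullet$, $\bullet\to\varnothing$, $\lambda\to\lambda\bullet\circ$, $\lambda\circ\to\lambda\circ\circ$, $\varnothing\to\circ$, with $\lambda$ an arbitrary weight. *)

theory Defs
  imports "Jordan_Normal_Form.Missing_VectorSpace" "HOL-Library.Sublist"
begin

section \<open>Weights\<close>

datatype letter = Black | White

type_synonym weight = "letter list"

definition alternating :: "weight \<Rightarrow> bool" where
  "alternating w \<longleftrightarrow> \<not> sublist [Black, Black] w \<and> \<not> sublist [White, White] w"

definition alt_weights :: "letter \<Rightarrow> weight set" where
  "alt_weights a = {w. w \<noteq> [] \<and> alternating w \<and> last w = a}"


section \<open>The linear category of weights\<close>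

definition linked :: "weight \<Rightarrow> weight \<Rightarrow> bool" where
  "linked l m \<longleftrightarrow>
     l = m \<or> m \<in> {l @ w | w. w \<in> alt_weights White} \<or> l \<in> {m @ w | w. w \<in> alt_weights Black}"

text \<open>The field \<open>K\<close> as a vector space over itself if \<open>P\<close> holds, and the zero space otherwise.
  The ring multiplication and unit of a \<^typ>\<open>('a, 'b) module\<close> record play no role for modules.\<close>

definition line :: "('a, 'r) ring_scheme \<Rightarrow> bool \<Rightarrow> ('a, 'a) module" where
  "line K P = \<lparr>carrier = {x \<in> carrier K. P \<or> x = \<zero>\<^bsub>K\<^esub>}, mult = undefined, one = undefined,
     zero = \<zero>\<^bsub>K\<^esub>, add = (\<oplus>\<^bsub>K\<^esub>), smult = (\<otimes>\<^bsub>K\<^esub>)\<rparr>"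

text \<open>A morphism is represented by its coordinate with respect to the distinguished basis vector,
  so the distinguished morphism, when there is one, is \<open>\<one>\<^bsub>K\<^esub>\<close>. The composition below is the
  bilinear extension of the rule for distinguished morphisms \<open>l \<rightarrow> m \<rightarrow> n\<close>; when \<open>Hom l m\<close> or
  \<open>Hom m n\<close> is zero, so is the product of the coordinates.\<close>

definition weight_hom :: "('a, 'r) ring_scheme \<Rightarrow> weight \<Rightarrow> weight \<Rightarrow> ('a, 'a) module" where
  "weight_hom K l m = line K (linked l m)"

definition distinguished :: "('a, 'r) ring_scheme \<Rightarrow> weight \<Rightarrow> weight \<Rightarrow> 'a \<Rightarrow> bool" where
  "distinguished K l m f \<longleftrightarrow> linked l m \<and> f = \<one>\<^bsub>K\<^esub>"

definition weight_comp :: "('a, 'r) ring_scheme \<Rightarrow> weight \<Rightarrow> weight \<Rightarrow> 'a \<Rightarrow> 'a \<Rightarrow> 'a" where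
  "weight_comp K l n g f = (if linked l n then g \<otimes>\<^bsub>K\<^esub> f else \<zero>\<^bsub>K\<^esub>)"

inductive basic :: "('a, 'r) ring_scheme \<Rightarrow> weight \<Rightarrow> weight \<Rightarrow> 'a \<Rightarrow> bool"
  for K :: "('a, 'r) ring_scheme" where
  "distinguished K (l @ [White, Black]) l f \<Longrightarrow> basic K (l @ [White, Black]) l f"
| "distinguished K (l @ [Black, Black]) (l @ [Black]) f
     \<Longrightarrow> basic K (l @ [Black, Black]) (l @ [Black]) f"
| "distinguished K [Black] [] f \<Longrightarrow> basic K [Black] [] f"
| "distinguished K l (l @ [Black, White]) f \<Longrightarrow> basic K l (l @ [Black, White]) f"
| "distinguished K (l @ [White]) (l @ [White, White]) f
     \<Longrightarrow> basic K (l @ [White]) (l @ [White, White]) f"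
| "distinguished K [] [White] f \<Longrightarrow> basic K [] [White] f"


section \<open>Linear functors to vector spaces\<close>

record ('a, 'v) weight_rep =
  space :: "weight \<Rightarrow> ('a, 'v) module"
  act :: "weight \<Rightarrow> weight \<Rightarrow> 'a \<Rightarrow> 'v \<Rightarrow> 'v"

definition linear_functor :: "('a, 'r) ring_scheme \<Rightarrow> ('a, 'v) weight_rep \<Rightarrow> bool" where
  "linear_functor K M \<longleftrightarrow>
     (\<forall>l. vectorspace K (space M l)) \<and>
     (\<forall>l m. \<forall>f \<in> carrier (weight_hom K l m). linear_map K (space M l) (space M m) (act M l m f)) \<and>
     (\<forall>l m. \<forall>f \<in> carrier (weight_hom K l m). \<forall>g \<in> carrier (weight_hom K l m).
        \<forall>x \<in> carrier (space M l).
          act M l m (f \<oplus>\<^bsub>weight_hom K l m\<^esub> g) x = act M l m f x \<oplus>\<^bsub>space M m\<^esub> act M l m g x) \<and>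
     (\<forall>l m. \<forall>c \<in> carrier K. \<forall>f \<in> carrier (weight_hom K l m). \<forall>x \<in> carrier (space M l).
          act M l m (c \<odot>\<^bsub>weight_hom K l m\<^esub> f) x = c \<odot>\<^bsub>space M m\<^esub> act M l m f x) \<and>
     (\<forall>l. \<forall>x \<in> carrier (space M l). act M l l \<one>\<^bsub>K\<^esub> x = x) \<and>
     (\<forall>l m n. \<forall>f \<in> carrier (weight_hom K l m). \<forall>g \<in> carrier (weight_hom K m n).
        \<forall>x \<in> carrier (space M l).
          act M l n (weight_comp K l n g f) x = act M m n g (act M l m f x))"

text \<open>The direct sum of the spaces of \<open>M\<close> over all weights.\<close>

definition total_space :: "('a, 'v) weight_rep \<Rightarrow> ('a, weight \<Rightarrow> 'v) module" where
  "total_space M =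
     \<lparr>carrier = {v. (\<forall>l. v l \<in> carrier (space M l)) \<and> finite {l. v l \<noteq> \<zero>\<^bsub>space M l\<^esub>}},
      mult = undefined, one = undefined,
      zero = (\<lambda>l. \<zero>\<^bsub>space M l\<^esub>),
      add = (\<lambda>v w l. v l \<oplus>\<^bsub>space M l\<^esub> w l),
      smult = (\<lambda>c v l. c \<odot>\<^bsub>space M l\<^esub> v l)\<rparr>"

definition finite_functor :: "('a, 'r) ring_scheme \<Rightarrow> ('a, 'v) weight_rep \<Rightarrow> bool" where
  "finite_functor K M \<longleftrightarrow> linear_functor K M \<and> vectorspace.fin_dim K (total_space M)"

definition nat_trans ::
    "('a, 'r) ring_scheme \<Rightarrow> ('a, 'v) weight_rep \<Rightarrow> ('a, 'w) weight_rep \<Rightarrow>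
     (weight \<Rightarrow> 'v \<Rightarrow> 'w) \<Rightarrow> bool" where
  "nat_trans K M N \<phi> \<longleftrightarrow>
     (\<forall>l. linear_map K (space M l) (space N l) (\<phi> l)) \<and>
     (\<forall>l m. \<forall>f \<in> carrier (weight_hom K l m). \<forall>x \<in> carrier (space M l).
        \<phi> m (act M l m f x) = act N l m f (\<phi> l x))"

definition simple :: "('a, 'r) ring_scheme \<Rightarrow> weight \<Rightarrow> ('a, 'a) weight_rep" where
  "simple K l =
     \<lparr>space = (\<lambda>m. line K (m = l)),
      act = (\<lambda>m n f x. if m = l \<and> n = l then f \<otimes>\<^bsub>K\<^esub> x else \<zero>\<^bsub>K\<^esub>)\<rparr>"

definition functor_sum ::
    "('a, 'v) weight_rep \<Rightarrow> ('a, 'w) weight_rep \<Rightarrow> ('a, 'v \<times> 'w) weight_rep" where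
  "functor_sum M N =
     \<lparr>space = (\<lambda>l. direct_sum (space M l) (space N l)),
      act = (\<lambda>l m f. map_prod (act M l m f) (act N l m f))\<rparr>"


section \<open>Extensions and the Yoneda Ext space\<close>

record ('a, 'u, 'v, 'w) ext_data =
  middle :: "('a, 'v) weight_rep"
  incl :: "weight \<Rightarrow> 'u \<Rightarrow> 'v"
  proj :: "weight \<Rightarrow> 'v \<Rightarrow> 'w"

text \<open>Short exact sequences \<open>0 \<rightarrow> A \<rightarrow> middle E \<rightarrow> C \<rightarrow> 0\<close>. Kernels and images of natural
  transformations are computed weight by weight, hence so is exactness.\<close>

definition extension ::
    "('a, 'r) ring_scheme \<Rightarrow> ('a, 'u) weight_rep \<Rightarrow> ('a, 'w) weight_rep \<Rightarrow>
     ('a, 'u, 'v, 'w) ext_data \<Rightarrow> bool" where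
  "extension K A C E \<longleftrightarrow>
     finite_functor K (middle E) \<and>
     nat_trans K A (middle E) (incl E) \<and>
     nat_trans K (middle E) C (proj E) \<and>
     (\<forall>l. inj_on (incl E l) (carrier (space A l)) \<and>
          incl E l ` carrier (space A l)
            = {x \<in> carrier (space (middle E) l). proj E l x = \<zero>\<^bsub>space C l\<^esub>} \<and>
          proj E l ` carrier (space (middle E) l) = carrier (space C l))"

text \<open>\<open>ext_morphism K A E E' \<alpha> \<gamma>\<close>: there is a morphism \<open>(\<alpha>, \<beta>, \<gamma>)\<close> of short exact sequences from
  \<open>E\<close>, whose left-hand term is \<open>A\<close>, to \<open>E'\<close>. If \<open>\<gamma>\<close> is an identity it exhibits \<open>E'\<close> as the
  pushout of \<open>E\<close> along \<open>\<alpha>\<close>; if \<open>\<alpha>\<close> is an identity it exhibits \<open>E\<close> as the pullback of \<open>E'\<close> along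
  \<open>\<gamma>\<close>; if both are, it is an equivalence of extensions (by the five lemma).\<close>

definition ext_morphism ::
    "('a, 'r) ring_scheme \<Rightarrow> ('a, 'u) weight_rep \<Rightarrow>
     ('a, 'u, 'v, 'w) ext_data \<Rightarrow> ('a, 'u2, 'v2, 'w2) ext_data \<Rightarrow>
     (weight \<Rightarrow> 'u \<Rightarrow> 'u2) \<Rightarrow> (weight \<Rightarrow> 'w \<Rightarrow> 'w2) \<Rightarrow> bool" where
  "ext_morphism K A E E' \<alpha> \<gamma> \<longleftrightarrow>
     (\<exists>\<beta>. nat_trans K (middle E) (middle E') \<beta> \<and>
       (\<forall>l. \<forall>a \<in> carrier (space A l). \<beta> l (incl E l a) = incl E' l (\<alpha> l a)) \<and>
       (\<forall>l. \<forall>x \<in> carrier (space (middle E) l). proj E' l (\<beta> l x) = \<gamma> l (proj E l x)))"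

text \<open>Every finite-dimensional vector space over a field with elements in \<open>'a\<close> is isomorphic to
  one with elements in \<open>nat \<Rightarrow> 'a\<close>, so each extension (with middle term in any type) is equivalent
  to one of the following type, and the latter suffice to form the set of equivalence classes.\<close>

type_synonym ('a, 'u, 'w) std_ext = "('a, 'u, nat \<Rightarrow> 'a, 'w) ext_data"

definition ext_class ::
    "('a, 'r) ring_scheme \<Rightarrow> ('a, 'u) weight_rep \<Rightarrow> ('a, 'w) weight_rep \<Rightarrow>
     ('a, 'u, 'v, 'w) ext_data \<Rightarrow> ('a, 'u, 'w) std_ext set" where
  "ext_class K A C E =
     {E'. extension K A C E' \<and> ext_morphism K A E E' (\<lambda>l a. a) (\<lambda>l c. c)}"

definition split_ext ::
    "('a, 'u) weight_rep \<Rightarrow> ('a, 'w) weight_rep \<Rightarrow> ('a, 'u, 'u \<times> 'w, 'w) ext_data" where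
  "split_ext A C =
     \<lparr>middle = functor_sum A C, incl = (\<lambda>l a. (a, \<zero>\<^bsub>space C l\<^esub>)), proj = (\<lambda>l. snd)\<rparr>"

definition ext_sum ::
    "('a, 'u, 'v, 'w) ext_data \<Rightarrow> ('a, 'u2, 'v2, 'w2) ext_data \<Rightarrow>
     ('a, 'u \<times> 'u2, 'v \<times> 'v2, 'w \<times> 'w2) ext_data" where
  "ext_sum E E' =
     \<lparr>middle = functor_sum (middle E) (middle E'),
      incl = (\<lambda>l. map_prod (incl E l) (incl E' l)),
      proj = (\<lambda>l. map_prod (proj E l) (proj E' l))\<rparr>"

text \<open>\<open>E\<close> is a Baer sum of \<open>E1\<close> and \<open>E2\<close>: with \<open>F\<close> the pullback of \<open>E1 \<oplus> E2\<close> along the diagonal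
  \<open>C \<rightarrow> C \<oplus> C\<close>, \<open>E\<close> is the pushout of \<open>F\<close> along the addition \<open>A \<oplus> A \<rightarrow> A\<close>.\<close>

definition baer_sum ::
    "('a, 'r) ring_scheme \<Rightarrow> ('a, 'u) weight_rep \<Rightarrow> ('a, 'w) weight_rep \<Rightarrow>
     ('a, 'u, 'w) std_ext \<Rightarrow> ('a, 'u, 'w) std_ext \<Rightarrow> ('a, 'u, 'w) std_ext \<Rightarrow> bool" where
  "baer_sum K A C E1 E2 E \<longleftrightarrow>
     (\<exists>F :: ('a, 'u \<times> 'u, 'w) std_ext.
        extension K (functor_sum A A) C F \<and>
        ext_morphism K (functor_sum A A) F (ext_sum E1 E2) (\<lambda>l a. a) (\<lambda>l c. (c, c)) \<and>
        ext_morphism K (functor_sum A A) F E (\<lambda>l (a, b). a \<oplus>\<^bsub>space A l\<^esub> b) (\<lambda>l c. c))"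

text \<open>\<open>Ext1 K C A\<close> is the space of classes of extensions \<open>0 \<rightarrow> A \<rightarrow> E \<rightarrow> C \<rightarrow> 0\<close>. The scalar \<open>c\<close>
  acts by pushout along multiplication by \<open>c\<close> on \<open>A\<close>.\<close>

definition Ext1 ::
    "('a, 'r) ring_scheme \<Rightarrow> ('a, 'w) weight_rep \<Rightarrow> ('a, 'u) weight_rep \<Rightarrow>
     ('a, ('a, 'u, 'w) std_ext set) module" where
  "Ext1 K C A =
     \<lparr>carrier = {ext_class K A C E | E :: ('a, 'u, 'w) std_ext. extension K A C E},
      mult = undefined, one = undefined,
      zero = ext_class K A C (split_ext A C),
      add = (\<lambda>X Y. {E. extension K A C E \<and> (\<exists>E1 \<in> X. \<exists>E2 \<in> Y. baer_sum K A C E1 E2 E)}),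
      smult = (\<lambda>c X. {E. extension K A C E \<and>
        (\<exists>E1 \<in> X. ext_morphism K A E1 E (\<lambda>l a. c \<odot>\<^bsub>space A l\<^esub> a) (\<lambda>l x. x))})\<rparr>"

end

theory Submission
  imports Defs
begin

text \<open>For \<open>l \<noteq> m\<close> an extension of \<open>S_l\<close> by \<open>S_m\<close> is, up to equivalence, one scalar: the
  coordinate \<open>t\<close> of the action of the distinguished morphism \<open>l \<rightarrow> m\<close> on the lift of \<open>1\<close>. If this
  morphism factors through a third weight \<open>x\<close>, then \<open>t = 0\<close> because the middle term vanishes at \<open>x\<close>;
  if it does not, every scalar gives a functor. As \<open>t\<close> is additive under Baer sums and multiplicative
  under pushouts, \<open>Ext\<^sup>1(S_l, S_m)\<close> is a line or zero according to whether \<open>l \<rightarrow> m\<close> is irreducible,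
  and the irreducible distinguished morphisms are exactly the basic ones.\<close>

section \<open>Irreducible links\<close>

text \<open>The obstacle is the form of \<open>Ext1\<close>: its elements are sets of extensions,
  and its operations refer to arbitrary representatives joined by unspecified pullback and pushout
  morphisms. Baer sums are therefore never manipulated directly. Each class is identified with the
  set of all extensions having a given scalar \<open>t\<close>, the scalar is followed along
  morphisms of extensions, and the vector space axioms are carried over from the field. What makes
  this work is a normal form, \<open>cocycle_ext\<close>, which maps to every extension with the
  same \<open>t\<close>. For distinct \<open>l\<close> and \<open>m\<close> the scalar does not
  depend on choices: the subobject vanishes at \<open>l\<close>, so 1 has only one lift. For
  \<open>l = m\<close> there is nothing to record, because the endomorphisms of \<open>l\<close> are
  multiples of the identity, which must act as the identity; this is handled as one more reducible
  case with \<open>t = 0\<close>. That every scalar is realised on an irreducible link comes down to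
  the composition law: a product \<open>g f\<close> through a third weight must vanish wherever the
  target functor could see it. Irreducibility gives this for \<open>l\<close> to \<open>m\<close>,
  antisymmetry of \<open>linked\<close> for round trips.\<close>

fun other :: "letter \<Rightarrow> letter" where
  "other Black = White"
| "other White = Black"

lemma neq_letter_iff: "c \<noteq> a \<longleftrightarrow> c = other a"
  by (cases a; cases c) auto

lemma other_other [simp]: "other (other a) = a"
  by (cases a) auto

lemma other_neq [simp]: "other a \<noteq> a"
  by (cases a) auto

lemma alternating_iff_successively: "alternating w \<longleftrightarrow> successively (\<noteq>) w"
proof -
  have *: "(\<not> sublist [Black, Black] w \<and> \<not> sublist [White, White] w) = (\<forall>a. \<not> sublist [a, a] w)"
    by (metis letter.exhaust)
  have "(\<forall>a. \<not> sublist [a, a] w) \<longleftrightarrow> successively (\<noteq>) w"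
  proof (induction w rule: induct_list012)
    case (3 x y zs)
    have "(\<forall>a. \<not> sublist [a, a] (x # y # zs)) \<longleftrightarrow> x \<noteq> y \<and> (\<forall>a. \<not> sublist [a, a] (y # zs))"
      unfolding sublist_Cons_right[of _ x] by auto
    with "3.IH"(2) show ?case by simp
  qed (auto simp: sublist_code)
  then show ?thesis unfolding alternating_def * .
qed

text \<open>The last letter of an alternating word determines the whole word read backwards, so
  words are taken apart from the right end, the end at which weights are modified.\<close>

lemma alt_weights_snoc:
  "w @ [b] \<in> alt_weights a \<longleftrightarrow> b = a \<and> (w = [] \<or> w \<in> alt_weights (other a))"
  by (cases "w = []")
     (auto simp: alt_weights_def alternating_iff_successively successively_append_iff
        simp flip: neq_letter_iff)

lemma Nil_notin_alt_weights [simp]: "[] \<notin> alt_weights a"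
  by (simp add: alt_weights_def)

lemma singleton_in_alt_weights [simp]: "[b] \<in> alt_weights a \<longleftrightarrow> b = a"
  using alt_weights_snoc[of "[]"] by simp

lemma doubleton_in_alt_weights [simp]: "[c, b] \<in> alt_weights a \<longleftrightarrow> b = a \<and> c = other a"
  using alt_weights_snoc[of "[c]"] by simp

lemma alt_weights_append_last:
  "v @ w \<in> alt_weights a \<Longrightarrow> w \<noteq> [] \<Longrightarrow> v \<in> alt_weights b \<Longrightarrow> hd w = other b"
  by (auto simp: alt_weights_def alternating_iff_successively successively_append_iff
      simp flip: neq_letter_iff)

definition alt_step :: "letter \<Rightarrow> weight \<Rightarrow> weight \<Rightarrow> bool" where
  "alt_step a l m \<longleftrightarrow> (\<exists>w \<in> alt_weights a. m = l @ w)"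

lemma alt_step_length: "alt_step a l m \<Longrightarrow> length l < length m"
  by (auto simp: alt_step_def alt_weights_def)

lemma alt_step_last: "alt_step a l m \<Longrightarrow> m \<noteq> [] \<and> last m = a"
  by (auto simp: alt_step_def alt_weights_def)

text \<open>Exchanging the two letters reverses all morphisms, so the colour \<open>a\<close> is a parameter:
  \<open>a = White\<close> gives \<^const>\<open>linked\<close>, and \<open>a = Black\<close> gives its converse.\<close>

definition link :: "letter \<Rightarrow> weight \<Rightarrow> weight \<Rightarrow> bool" where
  "link a l m \<longleftrightarrow> l = m \<or> alt_step a l m \<or> alt_step (other a) m l"

lemma linked_iff_link: "linked l m \<longleftrightarrow> link White l m" "linked l m \<longleftrightarrow> link Black m l"
  by (auto simp: linked_def link_def alt_step_def)

lemma linked_refl [simp]: "linked l l"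
  by (simp add: linked_def)

text \<open>Between distinct linked weights the longer one decides the direction by its last letter:
  the morphism goes towards it if that letter is \<open>White\<close>, and away from it if it is
  \<open>Black\<close>.\<close>

lemma linked_antisym: "linked l m \<Longrightarrow> linked m l \<Longrightarrow> l = m"
  unfolding linked_iff_link(1) link_def
  by (metis alt_step_last alt_step_length other_neq less_asym)

text \<open>The negative condition merges two kinds of basic morphism, since a weight not ending in
  \<open>other a\<close> is empty or ends in \<open>a\<close>. It cannot be dropped: if
  \<open>l = p @ [other a]\<close>, then the link from \<open>l\<close> to \<open>l @ [a]\<close>
  passes through \<open>p\<close>.\<close>

definition elementary :: "letter \<Rightarrow> weight \<Rightarrow> weight \<Rightarrow> bool" where
  "elementary a l m \<longleftrightarrow> m = l @ [other a, a] \<or> (m = l @ [a] \<and> \<not> suffix [other a] l)"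

lemma elementary_alt_step: "elementary a l m \<Longrightarrow> alt_step a l m"
  by (auto simp: elementary_def alt_step_def)

text \<open>An intermediate \<open>x\<close> is reached and left by lengthening or shortening. Two
  lengthenings would cut the short word \<open>w\<close> into two pieces both ending in
  \<open>a\<close>. Lengthening then shortening would make \<open>x\<close> end in both letters. Two
  shortenings would make \<open>m\<close> shorter than \<open>l\<close>. Only shortening then
  lengthening uses the condition on the end of \<open>l\<close>.\<close>

lemma elementary_unfactorable:
  assumes "elementary a l m" "link a l x" "link a x m"
  shows "x = l \<or> x = m"
proof (rule ccontr)
  assume neq: "\<not> (x = l \<or> x = m)"
  obtain w where m: "m = l @ w" and w: "w = [other a, a] \<or> w = [a] \<and> \<not> suffix [other a] l"
    using assms(1) by (auto simp: elementary_def)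
  from assms neq consider "alt_step a l x" "alt_step a x m" | "alt_step a l x" "alt_step (other a) m x"
    | "alt_step (other a) x l" "alt_step a x m" | "alt_step (other a) x l" "alt_step (other a) m x"
    by (auto simp: link_def)
  then show False
  proof cases
    case 1
    then obtain u v where uv: "w = u @ v" "u \<in> alt_weights a" "v \<in> alt_weights a"
      by (auto simp: m alt_step_def)
    then have "u \<noteq> []" "v \<noteq> []" by auto
    with uv w show False by (auto simp: append_eq_Cons_conv Cons_eq_append_conv)
  next
    case 2
    then show False using alt_step_last other_neq by metis
  next
    case 3
    \<comment> \<open>The lengthening from \<open>x\<close> to \<open>m\<close> passes back through
      all of \<open>l\<close>, so the removed word \<open>u\<close> and the new word
      \<open>w\<close> form one alternating word. As \<open>u\<close> ends in
      \<open>other a\<close>, \<open>w\<close> must start with \<open>a\<close>, which leaves only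
      the one-letter case.\<close>
    then obtain u where u: "l = x @ u" "u \<in> alt_weights (other a)" "u @ w \<in> alt_weights a"
      by (auto simp: m alt_step_def)
    have "w \<noteq> []" using w by auto
    from alt_weights_append_last[OF u(3) this u(2)] have "hd w = a" by simp
    with w have "\<not> suffix [other a] l" by (metis list.sel(1) other_neq)
    moreover have "l \<noteq> []" "last l = other a"
      using alt_step_last 3 by blast+
    ultimately show False
      by (metis append_butlast_last_id suffixI)
  next
    case 4
    then have "length m < length l" using alt_step_length less_trans by blast
    with m show False by simp
  qed
qed

text \<open>Look at the appended word without its final \<open>a\<close>. If nothing remains,
  \<open>l\<close> ends in \<open>other a\<close>, and deleting that letter gives the intermediate
  weight. Otherwise the word ends in \<open>[other a, a]\<close>, and the part \<open>v\<close>
  before these two letters is non-empty and ends in \<open>a\<close>, so \<open>l @ v\<close> lies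
  strictly between.\<close>

lemma alt_step_factor:
  assumes "alt_step a l m" "\<not> elementary a l m"
  obtains x where "x \<noteq> l" "x \<noteq> m" "link a l x" "link a x m"
proof -
  obtain w where w: "w \<in> alt_weights a" "m = l @ w"
    using assms(1) by (auto simp: alt_step_def)
  obtain u where u: "w = u @ [a]" "u = [] \<or> u \<in> alt_weights (other a)"
    using w(1) by (cases w rule: rev_cases) (auto simp: alt_weights_snoc)
  show ?thesis
  proof (cases u rule: rev_cases)
    case Nil
    with assms(2) u w obtain p where p: "l = p @ [other a]"
      by (auto simp: elementary_def suffix_def)
    with Nil u w have "link a l p" "link a p m"
      by (auto simp: link_def alt_step_def)
    with p Nil u w show ?thesis by (intro that[of p]) auto
  next
    case (snoc v b)
    with u have b: "b = other a" and v: "v = [] \<or> v \<in> alt_weights a"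
      by (auto simp: alt_weights_snoc)
    have "v \<noteq> []" using assms(2) snoc b u w by (auto simp: elementary_def)
    with v snoc b u w have "link a l (l @ v)" "link a (l @ v) m"
      by (auto simp: link_def alt_step_def)
    with \<open>v \<noteq> []\<close> snoc u w show ?thesis by (intro that[of "l @ v"]) auto
  qed
qed

definition irreducible_link :: "weight \<Rightarrow> weight \<Rightarrow> bool" where
  "irreducible_link l m \<longleftrightarrow>
     l \<noteq> m \<and> linked l m \<and> (\<forall>x. linked l x \<longrightarrow> linked x m \<longrightarrow> x = l \<or> x = m)"

lemma irreducible_link_iff_elementary:
  "irreducible_link l m \<longleftrightarrow> elementary White l m \<or> elementary Black m l"
proof
  assume *: "elementary White l m \<or> elementary Black m l"
  then have "linked l m" "l \<noteq> m"
    using elementary_alt_step[of White l m] elementary_alt_step[of Black m l]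
    by (auto simp: linked_iff_link(1) link_def dest: alt_step_length)
  moreover have "x = l \<or> x = m" if "linked l x" "linked x m" for x
    using * elementary_unfactorable[of White l m x] elementary_unfactorable[of Black m l x] that
    by (metis linked_iff_link)
  ultimately show "irreducible_link l m" by (simp add: irreducible_link_def)
next
  assume irr: "irreducible_link l m"
  then consider "alt_step White l m" | "alt_step Black m l"
    by (auto simp: irreducible_link_def linked_iff_link(1) link_def)
  then show "elementary White l m \<or> elementary Black m l"
  proof cases
    case 1
    then show ?thesis
      using irr by (metis alt_step_factor irreducible_link_def linked_iff_link(1))
  next
    case 2
    then show ?thesis
      using irr by (metis alt_step_factor irreducible_link_def linked_iff_link(2))
  qed
qed

section \<open>Comparison with the basic morphisms\<close>

lemma elementary_White_iff:
  "elementary White l m \<longleftrightarrow> m = l @ [Black, White] \<or> m = l @ [White] \<and> \<not> suffix [Black] l"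
  by (simp add: elementary_def)

lemma elementary_Black_iff:
  "elementary Black m l \<longleftrightarrow> l = m @ [White, Black] \<or> l = m @ [Black] \<and> \<not> suffix [White] m"
  by (simp add: elementary_def)

lemma basic_iff_irreducible_link: "(\<exists>f. basic K l m f) \<longleftrightarrow> irreducible_link l m"
  unfolding irreducible_link_iff_elementary
proof
  assume "\<exists>f. basic K l m f"
  then show "elementary White l m \<or> elementary Black m l"
    by (auto simp: elementary_White_iff elementary_Black_iff elim!: basic.cases)
next
  assume *: "elementary White l m \<or> elementary Black m l"
  then have d: "distinguished K l m \<one>\<^bsub>K\<^esub>"
    using irreducible_link_iff_elementary[of l m] by (simp add: distinguished_def irreducible_link_def)
  \<comment> \<open>This splits each one-letter case of \<open>elementary\<close> back into the two
    rules of \<open>basic\<close> that it merges: one starting or ending at the empty weight, one at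
    a weight with a repeated final letter.\<close>
  have ends: "w = [] \<or> (\<exists>k. w = k @ [a])" if "\<not> suffix [other a] w" for w a
    using that by (cases w rule: rev_cases) (auto simp: suffix_def neq_letter_iff)
  from * consider "m = l @ [Black, White]" | "m = l @ [White]" "\<not> suffix [Black] l"
    | "l = m @ [White, Black]" | "l = m @ [Black]" "\<not> suffix [White] m"
    by (auto simp: elementary_White_iff elementary_Black_iff)
  then have "basic K l m \<one>\<^bsub>K\<^esub>"
  proof cases
    case 1
    with d show ?thesis by (auto intro: basic.intros(4))
  next
    case 2
    with d ends[of White l] show ?thesis by (auto intro: basic.intros(5,6))
  next
    case 3
    with d show ?thesis by (auto intro: basic.intros(1))
  next
    case 4
    with d ends[of Black m] show ?thesis by (auto intro: basic.intros(2,3))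
  qed
  then show "\<exists>f. basic K l m f" ..
qed

section \<open>Linear maps and coordinate spaces\<close>

lemma linear_mapI:
  assumes "vectorspace K V" "vectorspace K W"
    and "\<And>x. x \<in> carrier V \<Longrightarrow> T x \<in> carrier W"
    and "\<And>x y. x \<in> carrier V \<Longrightarrow> y \<in> carrier V \<Longrightarrow> T (x \<oplus>\<^bsub>V\<^esub> y) = T x \<oplus>\<^bsub>W\<^esub> T y"
    and "\<And>c x. c \<in> carrier K \<Longrightarrow> x \<in> carrier V \<Longrightarrow> T (c \<odot>\<^bsub>V\<^esub> x) = c \<odot>\<^bsub>W\<^esub> T x"
  shows "linear_map K V W T"
  using assms
  by (auto simp: linear_map_def mod_hom_def mod_hom_axioms_def module_hom_def vectorspace_def)

lemma linear_map_comp: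
  assumes "linear_map K U V S" "linear_map K V W T"
  shows "linear_map K U W (T \<circ> S)"
proof -
  interpret S: linear_map K U V S by fact
  interpret T: linear_map K V W T by fact
  show ?thesis
    by (rule linear_mapI) (auto intro: S.V.vectorspace_axioms T.W.vectorspace_axioms)
qed

text \<open>The axioms pass to any image under a map respecting the operations. Applied to
  \<open>cocycle_class\<close>, this yields associativity, inverses and distributivity for Baer sums
  with no diagram of extensions.\<close>

lemma vectorspace_transfer:
  assumes V: "vectorspace K V" and img: "h ` carrier V = carrier W"
    and zero: "h \<zero>\<^bsub>V\<^esub> = \<zero>\<^bsub>W\<^esub>"
    and add: "\<And>x y. x \<in> carrier V \<Longrightarrow> y \<in> carrier V \<Longrightarrow> h (x \<oplus>\<^bsub>V\<^esub> y) = h x \<oplus>\<^bsub>W\<^esub> h y"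
    and smult: "\<And>c x. c \<in> carrier K \<Longrightarrow> x \<in> carrier V \<Longrightarrow> h (c \<odot>\<^bsub>V\<^esub> x) = c \<odot>\<^bsub>W\<^esub> h x"
  shows "vectorspace K W"
proof -
  interpret V: vectorspace K V by fact
  \<comment> \<open>Quantifiers over \<open>W\<close> become quantifiers over \<open>V\<close>; each
    axiom of \<open>W\<close> is then the image under \<open>h\<close> of the same axiom of
    \<open>V\<close>.\<close>
  have ball: "(\<forall>y \<in> carrier W. P y) \<longleftrightarrow> (\<forall>x \<in> carrier V. P (h x))" for P
    by (simp flip: img)
  have bex: "(\<exists>y \<in> carrier W. P y) \<longleftrightarrow> (\<exists>x \<in> carrier V. P (h x))" for P
    by (simp flip: img)
  have closed: "h x \<in> carrier W" if "x \<in> carrier V" for x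
    using img that by blast
  show ?thesis
  proof (rule vs_criteria)
    show "field K" by (rule V.field_axioms)
    show "\<zero>\<^bsub>W\<^esub> \<in> carrier W"
      using closed[OF V.M.zero_closed] by (simp add: zero)
    have "\<forall>v\<in>carrier W. \<forall>w\<in>carrier W. v \<oplus>\<^bsub>W\<^esub> w \<in> carrier W"
      unfolding ball by (simp add: closed flip: add)
    then show "\<forall>v w. v \<in> carrier W \<and> w \<in> carrier W \<longrightarrow> v \<oplus>\<^bsub>W\<^esub> w \<in> carrier W" by blast
    show "\<forall>v\<in>carrier W. \<exists>neg_v\<in>carrier W. v \<oplus>\<^bsub>W\<^esub> neg_v = \<zero>\<^bsub>W\<^esub>"
      unfolding ball bex by (metis V.M.a_inv_closed V.M.r_neg add zero)
    have "\<forall>v\<in>carrier W. \<forall>c\<in>carrier K. c \<odot>\<^bsub>W\<^esub> v \<in> carrier W"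
      unfolding ball by (simp add: closed flip: smult)
    then show "\<forall>c v. c \<in> carrier K \<and> v \<in> carrier W \<longrightarrow> c \<odot>\<^bsub>W\<^esub> v \<in> carrier W" by blast
    have "\<forall>v\<in>carrier W. \<forall>w\<in>carrier W. v \<oplus>\<^bsub>W\<^esub> w = w \<oplus>\<^bsub>W\<^esub> v"
      unfolding ball by (metis V.M.a_comm add)
    then show "\<forall>v w. v \<in> carrier W \<and> w \<in> carrier W \<longrightarrow> v \<oplus>\<^bsub>W\<^esub> w = w \<oplus>\<^bsub>W\<^esub> v" by blast
    have "\<forall>v\<in>carrier W. \<forall>w\<in>carrier W. \<forall>x\<in>carrier W. v \<oplus>\<^bsub>W\<^esub> w \<oplus>\<^bsub>W\<^esub> x = v \<oplus>\<^bsub>W\<^esub> (w \<oplus>\<^bsub>W\<^esub> x)"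
      unfolding ball by (simp add: V.M.a_assoc flip: add)
    then show "\<forall>v w x. v \<in> carrier W \<and> w \<in> carrier W \<and> x \<in> carrier W \<longrightarrow>
      v \<oplus>\<^bsub>W\<^esub> w \<oplus>\<^bsub>W\<^esub> x = v \<oplus>\<^bsub>W\<^esub> (w \<oplus>\<^bsub>W\<^esub> x)" by blast
    show "\<forall>v\<in>carrier W. v \<oplus>\<^bsub>W\<^esub> \<zero>\<^bsub>W\<^esub> = v"
      unfolding ball by (simp flip: add zero)
    have "\<forall>v\<in>carrier W. \<forall>a\<in>carrier K. \<forall>b\<in>carrier K. (a \<otimes>\<^bsub>K\<^esub> b) \<odot>\<^bsub>W\<^esub> v = a \<odot>\<^bsub>W\<^esub> (b \<odot>\<^bsub>W\<^esub> v)"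
      unfolding ball by (simp add: V.smult_assoc1 flip: smult)
    then show "\<forall>a b v. a \<in> carrier K \<and> b \<in> carrier K \<and> v \<in> carrier W \<longrightarrow>
      (a \<otimes>\<^bsub>K\<^esub> b) \<odot>\<^bsub>W\<^esub> v = a \<odot>\<^bsub>W\<^esub> (b \<odot>\<^bsub>W\<^esub> v)" by blast
    show "\<forall>v\<in>carrier W. \<one>\<^bsub>K\<^esub> \<odot>\<^bsub>W\<^esub> v = v"
      unfolding ball by (simp flip: smult)
    have "\<forall>v\<in>carrier W. \<forall>a\<in>carrier K. \<forall>b\<in>carrier K.
        (a \<oplus>\<^bsub>K\<^esub> b) \<odot>\<^bsub>W\<^esub> v = a \<odot>\<^bsub>W\<^esub> v \<oplus>\<^bsub>W\<^esub> b \<odot>\<^bsub>W\<^esub> v"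
      unfolding ball by (simp add: V.smult_l_distr flip: smult add)
    then show "\<forall>a b v. a \<in> carrier K \<and> b \<in> carrier K \<and> v \<in> carrier W \<longrightarrow>
      (a \<oplus>\<^bsub>K\<^esub> b) \<odot>\<^bsub>W\<^esub> v = a \<odot>\<^bsub>W\<^esub> v \<oplus>\<^bsub>W\<^esub> b \<odot>\<^bsub>W\<^esub> v" by blast
    have "\<forall>v\<in>carrier W. \<forall>w\<in>carrier W. \<forall>a\<in>carrier K.
        a \<odot>\<^bsub>W\<^esub> (v \<oplus>\<^bsub>W\<^esub> w) = a \<odot>\<^bsub>W\<^esub> v \<oplus>\<^bsub>W\<^esub> a \<odot>\<^bsub>W\<^esub> w"
      unfolding ball by (simp add: V.smult_r_distr flip: smult add)
    then show "\<forall>a v w. a \<in> carrier K \<and> v \<in> carrier W \<and> w \<in> carrier W \<longrightarrow>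
      a \<odot>\<^bsub>W\<^esub> (v \<oplus>\<^bsub>W\<^esub> w) = a \<odot>\<^bsub>W\<^esub> v \<oplus>\<^bsub>W\<^esub> a \<odot>\<^bsub>W\<^esub> w" by blast
  qed
qed

lemma line_simps [simp]:
  "x \<in> carrier (line K P) \<longleftrightarrow> x \<in> carrier K \<and> (P \<or> x = \<zero>\<^bsub>K\<^esub>)"
  "\<zero>\<^bsub>line K P\<^esub> = \<zero>\<^bsub>K\<^esub>" "x \<oplus>\<^bsub>line K P\<^esub> y = x \<oplus>\<^bsub>K\<^esub> y" "c \<odot>\<^bsub>line K P\<^esub> x = c \<otimes>\<^bsub>K\<^esub> x"
  by (auto simp: line_def)

lemma weight_hom_simps [simp]:
  "f \<in> carrier (weight_hom K l m) \<longleftrightarrow> f \<in> carrier K \<and> (linked l m \<or> f = \<zero>\<^bsub>K\<^esub>)"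
  "f \<oplus>\<^bsub>weight_hom K l m\<^esub> g = f \<oplus>\<^bsub>K\<^esub> g" "c \<odot>\<^bsub>weight_hom K l m\<^esub> f = c \<otimes>\<^bsub>K\<^esub> f"
  by (auto simp: weight_hom_def)

lemma direct_sum_simps [simp]:
  "carrier (direct_sum V W) = carrier V \<times> carrier W"
  "\<zero>\<^bsub>direct_sum V W\<^esub> = (\<zero>\<^bsub>V\<^esub>, \<zero>\<^bsub>W\<^esub>)"
  "v \<oplus>\<^bsub>direct_sum V W\<^esub> w = (fst v \<oplus>\<^bsub>V\<^esub> fst w, snd v \<oplus>\<^bsub>W\<^esub> snd w)"
  "c \<odot>\<^bsub>direct_sum V W\<^esub> v = (c \<odot>\<^bsub>V\<^esub> fst v, c \<odot>\<^bsub>W\<^esub> snd v)"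
  by (auto simp: direct_sum_def)

text \<open>Coordinates outside \<open>Q\<close> are kept and set to zero, so that the values of a
  functor at all weights share the type \<open>nat \<Rightarrow> 'a\<close> prescribed by
  \<open>std_ext\<close>.\<close>

definition coord_space :: "('a, 'r) ring_scheme \<Rightarrow> ('i \<Rightarrow> bool) \<Rightarrow> ('a, 'i \<Rightarrow> 'a) module" where
  "coord_space K Q = \<lparr>carrier = {v. \<forall>i. v i \<in> carrier (line K (Q i))},
     mult = undefined, one = undefined, zero = (\<lambda>i. \<zero>\<^bsub>K\<^esub>),
     add = (\<lambda>v w i. v i \<oplus>\<^bsub>K\<^esub> w i), smult = (\<lambda>c v i. c \<otimes>\<^bsub>K\<^esub> v i)\<rparr>"

lemma coord_space_simps [simp]:
  "v \<in> carrier (coord_space K Q) \<longleftrightarrow> (\<forall>i. v i \<in> carrier K \<and> (Q i \<or> v i = \<zero>\<^bsub>K\<^esub>))"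
  "\<zero>\<^bsub>coord_space K Q\<^esub> = (\<lambda>i. \<zero>\<^bsub>K\<^esub>)"
  "v \<oplus>\<^bsub>coord_space K Q\<^esub> w = (\<lambda>i. v i \<oplus>\<^bsub>K\<^esub> w i)"
  "c \<odot>\<^bsub>coord_space K Q\<^esub> v = (\<lambda>i. c \<otimes>\<^bsub>K\<^esub> v i)"
  by (auto simp: coord_space_def)

context field
begin

lemma field_R: "field R" ..

lemma vectorspace_coord_space: "vectorspace R (coord_space R Q)"
proof (rule vs_criteria)
  show "\<forall>v w. v \<in> carrier (coord_space R Q) \<and> w \<in> carrier (coord_space R Q) \<longrightarrow>
      v \<oplus>\<^bsub>coord_space R Q\<^esub> w \<in> carrier (coord_space R Q)"
    unfolding coord_space_simps by (metis a_closed r_zero zero_closed)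
  show "\<forall>c v. c \<in> carrier R \<and> v \<in> carrier (coord_space R Q) \<longrightarrow>
      c \<odot>\<^bsub>coord_space R Q\<^esub> v \<in> carrier (coord_space R Q)"
    unfolding coord_space_simps by (metis m_closed r_null)
  show "\<forall>v\<in>carrier (coord_space R Q). \<exists>w\<in>carrier (coord_space R Q).
      v \<oplus>\<^bsub>coord_space R Q\<^esub> w = \<zero>\<^bsub>coord_space R Q\<^esub>"
  proof
    fix v assume v: "v \<in> carrier (coord_space R Q)"
    then have "(\<lambda>i. \<ominus> v i) \<in> carrier (coord_space R Q)"
      unfolding coord_space_simps by (metis a_inv_closed minus_zero)
    moreover have "v \<oplus>\<^bsub>coord_space R Q\<^esub> (\<lambda>i. \<ominus> v i) = \<zero>\<^bsub>coord_space R Q\<^esub>"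
      using v by (simp add: r_neg)
    ultimately show "\<exists>w\<in>carrier (coord_space R Q). v \<oplus>\<^bsub>coord_space R Q\<^esub> w = \<zero>\<^bsub>coord_space R Q\<^esub>"
      by blast
  qed
  show "\<forall>v w. v \<in> carrier (coord_space R Q) \<and> w \<in> carrier (coord_space R Q) \<longrightarrow>
      v \<oplus>\<^bsub>coord_space R Q\<^esub> w = w \<oplus>\<^bsub>coord_space R Q\<^esub> v"
    by (simp add: a_comm)
qed (simp_all add: field_R a_assoc m_assoc l_distr r_distr)

text \<open>A line is a coordinate space with a one-element index set.\<close>

lemma vectorspace_line: "vectorspace R (line R P)"
proof (rule vectorspace_transfer[OF vectorspace_coord_space])
  show "(\<lambda>v. v ()) ` carrier (coord_space R (\<lambda>_. P)) = carrier (line R P)"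
  proof (intro equalityI subsetI)
    fix x assume "x \<in> carrier (line R P)"
    then show "x \<in> (\<lambda>v. v ()) ` carrier (coord_space R (\<lambda>_. P))"
      by (intro image_eqI[of _ _ "\<lambda>_. x"]) simp_all
  qed auto
qed simp_all

end

section \<open>Morphisms of extensions\<close>

lemma linear_map_inv_into:
  assumes "linear_map K V W T" and bij: "bij_betw T (carrier V) (carrier W)"
  shows "linear_map K W V (inv_into (carrier V) T)"
proof -
  interpret T: linear_map K V W T by fact
  let ?S = "inv_into (carrier V) T"
  have S: "?S y \<in> carrier V" "T (?S y) = y" if "y \<in> carrier W" for y
    using bij that by (auto simp: bij_betw_def inv_into_into f_inv_into_f)
  have eq: "?S y = x" if "x \<in> carrier V" "T x = y" for x y
    using bij that by (auto simp: bij_betw_def)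
  show ?thesis
    by (rule linear_mapI) (auto intro!: eq T.V.vectorspace_axioms T.W.vectorspace_axioms simp: S)
qed

lemma nat_transI:
  assumes "\<And>l. linear_map K (space M l) (space N l) (\<phi> l)"
    and "\<And>l m f x. f \<in> carrier (weight_hom K l m) \<Longrightarrow> x \<in> carrier (space M l) \<Longrightarrow>
      \<phi> m (act M l m f x) = act N l m f (\<phi> l x)"
  shows "nat_trans K M N \<phi>"
  using assms by (simp add: nat_trans_def del: weight_hom_simps)

lemma nat_transD:
  assumes "nat_trans K M N \<phi>"
  shows "linear_map K (space M l) (space N l) (\<phi> l)"
    and "x \<in> carrier (space M l) \<Longrightarrow> \<phi> l x \<in> carrier (space N l)"
    and "f \<in> carrier (weight_hom K l m) \<Longrightarrow> x \<in> carrier (space M l) \<Longrightarrow>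
      \<phi> m (act M l m f x) = act N l m f (\<phi> l x)"
proof -
  show *: "linear_map K (space M l) (space N l) (\<phi> l)" for l
    using assms by (simp add: nat_trans_def)
  show "x \<in> carrier (space M l) \<Longrightarrow> \<phi> l x \<in> carrier (space N l)"
    using linear_map.axioms(3)[OF *] by (rule mod_hom.f_im)
  show "f \<in> carrier (weight_hom K l m) \<Longrightarrow> x \<in> carrier (space M l) \<Longrightarrow>
      \<phi> m (act M l m f x) = act N l m f (\<phi> l x)"
    using assms unfolding nat_trans_def by blast
qed

lemma linear_functorD:
  assumes "linear_functor K M"
  shows "vectorspace K (space M l)"
    and "f \<in> carrier (weight_hom K l m) \<Longrightarrow> linear_map K (space M l) (space M m) (act M l m f)"
    and "f \<in> carrier (weight_hom K l m) \<Longrightarrow> x \<in> carrier (space M l) \<Longrightarrow>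
      act M l m f x \<in> carrier (space M m)"
    and "c \<in> carrier K \<Longrightarrow> f \<in> carrier (weight_hom K l m) \<Longrightarrow> x \<in> carrier (space M l) \<Longrightarrow>
      act M l m (c \<otimes>\<^bsub>K\<^esub> f) x = c \<odot>\<^bsub>space M m\<^esub> act M l m f x"
    and "x \<in> carrier (space M l) \<Longrightarrow> act M l l \<one>\<^bsub>K\<^esub> x = x"
    and "f \<in> carrier (weight_hom K l m) \<Longrightarrow> g \<in> carrier (weight_hom K m n) \<Longrightarrow>
      x \<in> carrier (space M l) \<Longrightarrow>
      act M l n (weight_comp K l n g f) x = act M m n g (act M l m f x)"
proof -
  show "vectorspace K (space M l)" using assms by (simp add: linear_functor_def)
  show *: "f \<in> carrier (weight_hom K l m) \<Longrightarrow> linear_map K (space M l) (space M m) (act M l m f)" for l m f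
    using assms by (simp add: linear_functor_def del: weight_hom_simps)
  show "f \<in> carrier (weight_hom K l m) \<Longrightarrow> x \<in> carrier (space M l) \<Longrightarrow>
      act M l m f x \<in> carrier (space M m)"
    using linear_map.axioms(3)[OF *] by (rule mod_hom.f_im)
qed (use assms in \<open>simp_all add: linear_functor_def\<close>)

lemma ext_morphism_trans:
  assumes "ext_morphism K A E E' \<alpha> \<gamma>" "ext_morphism K A' E' E'' \<alpha>' \<gamma>'"
    and "\<And>l a. a \<in> carrier (space A l) \<Longrightarrow> \<alpha> l a \<in> carrier (space A' l)"
  shows "ext_morphism K A E E'' (\<lambda>l. \<alpha>' l \<circ> \<alpha> l) (\<lambda>l. \<gamma>' l \<circ> \<gamma> l)"
proof -
  from assms(1) obtain \<beta> where \<beta>: "nat_trans K (middle E) (middle E') \<beta>"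
    "\<And>l a. a \<in> carrier (space A l) \<Longrightarrow> \<beta> l (incl E l a) = incl E' l (\<alpha> l a)"
    "\<And>l x. x \<in> carrier (space (middle E) l) \<Longrightarrow> proj E' l (\<beta> l x) = \<gamma> l (proj E l x)"
    unfolding ext_morphism_def by blast
  from assms(2) obtain \<beta>' where \<beta>': "nat_trans K (middle E') (middle E'') \<beta>'"
    "\<And>l a. a \<in> carrier (space A' l) \<Longrightarrow> \<beta>' l (incl E' l a) = incl E'' l (\<alpha>' l a)"
    "\<And>l x. x \<in> carrier (space (middle E') l) \<Longrightarrow> proj E'' l (\<beta>' l x) = \<gamma>' l (proj E' l x)"
    unfolding ext_morphism_def by blast
  have "nat_trans K (middle E) (middle E'') (\<lambda>l. \<beta>' l \<circ> \<beta> l)"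
  proof (rule nat_transI)
    show "linear_map K (space (middle E) l) (space (middle E'') l) (\<beta>' l \<circ> \<beta> l)" for l
      by (rule linear_map_comp[OF nat_transD(1)[OF \<beta>(1)] nat_transD(1)[OF \<beta>'(1)]])
    show "(\<beta>' m \<circ> \<beta> m) (act (middle E) l m f x) = act (middle E'') l m f ((\<beta>' l \<circ> \<beta> l) x)"
      if "f \<in> carrier (weight_hom K l m)" "x \<in> carrier (space (middle E) l)" for l m f x
      using that by (simp add: nat_transD[OF \<beta>(1)] nat_transD[OF \<beta>'(1)] del: weight_hom_simps)
  qed
  then show ?thesis
    unfolding ext_morphism_def using \<beta> \<beta>' assms(3)
    by (intro exI[of _ "\<lambda>l. \<beta>' l \<circ> \<beta> l"]) (simp add: nat_transD(2)[OF \<beta>(1)])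
qed

text \<open>\<open>ext_class\<close> asks for a morphism in one direction only. The short five lemma
  at each weight makes \<open>\<beta>\<close> bijective, and its inverses again commute with the
  action, the inclusions and the projections.\<close>

lemma ext_morphism_sym:
  assumes E: "extension K A C E" and E': "extension K A C E'"
    and "ext_morphism K A E E' (\<lambda>l a. a) (\<lambda>l c. c)"
  shows "ext_morphism K A E' E (\<lambda>l a. a) (\<lambda>l c. c)"
proof -
  from assms(3) obtain \<beta> where \<beta>: "nat_trans K (middle E) (middle E') \<beta>"
    "\<And>l a. a \<in> carrier (space A l) \<Longrightarrow> \<beta> l (incl E l a) = incl E' l a"
    "\<And>l x. x \<in> carrier (space (middle E) l) \<Longrightarrow> proj E' l (\<beta> l x) = proj E l x"
    unfolding ext_morphism_def by blast
  from E have nat: "linear_functor K (middle E)" "nat_trans K A (middle E) (incl E)"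
      "nat_trans K (middle E) C (proj E)"
    and ker: "\<And>l. incl E l ` carrier (space A l)
       = {x \<in> carrier (space (middle E) l). proj E l x = \<zero>\<^bsub>space C l\<^esub>}"
    and surj: "\<And>l. proj E l ` carrier (space (middle E) l) = carrier (space C l)"
    unfolding extension_def finite_functor_def by auto
  from E' have nat': "nat_trans K A (middle E') (incl E')" "nat_trans K (middle E') C (proj E')"
    and inj': "\<And>l. inj_on (incl E' l) (carrier (space A l))"
    and ker': "\<And>l. incl E' l ` carrier (space A l)
       = {x \<in> carrier (space (middle E') l). proj E' l x = \<zero>\<^bsub>space C l\<^esub>}"
    unfolding extension_def finite_functor_def by auto
  have bij: "bij_betw (\<beta> l) (carrier (space (middle E) l)) (carrier (space (middle E') l))" for l
  proof -
    interpret A: vectorspace K "space A l"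
      using nat_transD(1)[OF nat(2), of l] by (simp add: linear_map_def)
    interpret C: vectorspace K "space C l"
      using nat_transD(1)[OF nat(3), of l] by (simp add: linear_map_def)
    interpret M: vectorspace K "space (middle E) l"
      using nat_transD(1)[OF nat(2), of l] by (simp add: linear_map_def)
    interpret M': vectorspace K "space (middle E') l"
      using nat_transD(1)[OF nat'(1), of l] by (simp add: linear_map_def)
    interpret b: linear_map K "space (middle E) l" "space (middle E') l" "\<beta> l"
      by (rule nat_transD(1)[OF \<beta>(1)])
    interpret i: linear_map K "space A l" "space (middle E) l" "incl E l"
      by (rule nat_transD(1)[OF nat(2)])
    interpret i': linear_map K "space A l" "space (middle E') l" "incl E' l"
      by (rule nat_transD(1)[OF nat'(1)])
    interpret p: linear_map K "space (middle E) l" "space C l" "proj E l"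
      by (rule nat_transD(1)[OF nat(3)])
    interpret p': linear_map K "space (middle E') l" "space C l" "proj E' l"
      by (rule nat_transD(1)[OF nat'(2)])
    have ker0: "x = \<zero>\<^bsub>space (middle E) l\<^esub>"
      if x: "x \<in> carrier (space (middle E) l)" "\<beta> l x = \<zero>\<^bsub>space (middle E') l\<^esub>" for x
    proof -
      have "proj E l x = \<zero>\<^bsub>space C l\<^esub>"
        using \<beta>(3)[OF x(1)] x(2) by simp
      with x(1) obtain a where a: "a \<in> carrier (space A l)" "x = incl E l a"
        using ker[of l] by blast
      then have "incl E' l a = incl E' l \<zero>\<^bsub>space A l\<^esub>"
        using \<beta>(2)[OF a(1)] x(2) by simp
      then have "a = \<zero>\<^bsub>space A l\<^esub>"
        by (rule inj_onD[OF inj' _ a(1) A.M.zero_closed])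
      with a(2) show ?thesis by simp
    qed
    have "inj_on (\<beta> l) (carrier (space (middle E) l))"
    proof (rule inj_onI)
      fix x y assume x: "x \<in> carrier (space (middle E) l)" and y: "y \<in> carrier (space (middle E) l)"
        and "\<beta> l x = \<beta> l y"
      then have "\<beta> l (x \<ominus>\<^bsub>space (middle E) l\<^esub> y) = \<zero>\<^bsub>space (middle E') l\<^esub>"
        by (simp add: M'.M.minus_other_side)
      with x y show "x = y"
        using ker0[of "x \<ominus>\<^bsub>space (middle E) l\<^esub> y"] M.M.minus_other_side by simp
    qed
    moreover have "y \<in> \<beta> l ` carrier (space (middle E) l)" if y: "y \<in> carrier (space (middle E') l)" for y
    proof -
      have "proj E' l y \<in> carrier (space C l)" using y by simp
      then obtain x where x: "x \<in> carrier (space (middle E) l)" "proj E l x = proj E' l y"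
        using surj[of l] by (metis imageE)
      \<comment> \<open>The lift \<open>x\<close> need not map to \<open>y\<close>, but the error
        lies in the kernel of \<open>proj E'\<close>, hence comes from some \<open>a\<close> in
        \<open>A\<close>; adding \<open>incl E l a\<close> to \<open>x\<close> corrects it.\<close>
      then have "proj E' l (y \<ominus>\<^bsub>space (middle E') l\<^esub> \<beta> l x) = \<zero>\<^bsub>space C l\<^esub>"
        using y by (simp add: \<beta>(3) C.M.minus_other_side)
      moreover have "y \<ominus>\<^bsub>space (middle E') l\<^esub> \<beta> l x \<in> carrier (space (middle E') l)"
        using x y by simp
      ultimately obtain a where a: "a \<in> carrier (space A l)"
        "y \<ominus>\<^bsub>space (middle E') l\<^esub> \<beta> l x = incl E' l a"
        using ker'[of l] by blast
      have "\<beta> l (incl E l a \<oplus>\<^bsub>space (middle E) l\<^esub> x) = y \<ominus>\<^bsub>space (middle E') l\<^esub> \<beta> l x \<oplus>\<^bsub>space (middle E') l\<^esub> \<beta> l x"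
        using a x by (simp add: \<beta>(2))
      also have "\<dots> = y"
        using x y by (simp add: a_minus_def M'.M.a_assoc M'.M.l_neg)
      finally show ?thesis
        using a(1) x(1) by (metis M.M.a_closed i.f_im image_eqI)
    qed
    ultimately show ?thesis by (auto simp: bij_betw_def)
  qed
  let ?\<delta> = "\<lambda>l. inv_into (carrier (space (middle E) l)) (\<beta> l)"
  have \<delta>: "?\<delta> l y \<in> carrier (space (middle E) l)" "\<beta> l (?\<delta> l y) = y"
    if "y \<in> carrier (space (middle E') l)" for l y
    using bij[of l] that by (auto simp: bij_betw_def inv_into_into f_inv_into_f)
  have eq: "?\<delta> l y = x" if "x \<in> carrier (space (middle E) l)" "\<beta> l x = y" for l x y
    using bij[of l] that by (auto simp: bij_betw_def)
  have "nat_trans K (middle E') (middle E) ?\<delta>"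
  proof (rule nat_transI)
    show "linear_map K (space (middle E') l) (space (middle E) l) (?\<delta> l)" for l
      by (rule linear_map_inv_into[OF nat_transD(1)[OF \<beta>(1)] bij])
    show "?\<delta> m (act (middle E') l m f y) = act (middle E) l m f (?\<delta> l y)"
      if "f \<in> carrier (weight_hom K l m)" "y \<in> carrier (space (middle E') l)" for l m f y
      using that
      by (intro eq linear_functorD(3)[OF nat(1)])
         (simp_all add: \<delta> nat_transD[OF \<beta>(1)] del: weight_hom_simps)
  qed
  moreover have "?\<delta> l (incl E' l a) = incl E l a" if "a \<in> carrier (space A l)" for l a
    using that by (intro eq nat_transD(2)[OF nat(2)]) (simp_all add: \<beta>(2))
  moreover have "proj E l (?\<delta> l y) = proj E' l y" if "y \<in> carrier (space (middle E') l)" for l y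
    using \<beta>(3)[OF \<delta>(1)[OF that]] \<delta>(2)[OF that] by simp
  ultimately show ?thesis
    unfolding ext_morphism_def by blast
qed

section \<open>Functors in coordinates\<close>

lemma total_space_simps [simp]:
  "v \<in> carrier (total_space M) \<longleftrightarrow>
     (\<forall>l. v l \<in> carrier (space M l)) \<and> finite {l. v l \<noteq> \<zero>\<^bsub>space M l\<^esub>}"
  "\<zero>\<^bsub>total_space M\<^esub> = (\<lambda>l. \<zero>\<^bsub>space M l\<^esub>)"
  "v \<oplus>\<^bsub>total_space M\<^esub> w = (\<lambda>l. v l \<oplus>\<^bsub>space M l\<^esub> w l)"
  "c \<odot>\<^bsub>total_space M\<^esub> v = (\<lambda>l. c \<odot>\<^bsub>space M l\<^esub> v l)"
  by (auto simp: total_space_def)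

lemma vectorspace_total_space:
  assumes "\<And>l. vectorspace K (space M l)"
  shows "vectorspace K (total_space M)"
proof -
  interpret V: vectorspace K "space M l" for l by fact
  show ?thesis
  proof (rule vs_criteria)
    show "field K" ..
    show "\<forall>v w. v \<in> carrier (total_space M) \<and> w \<in> carrier (total_space M) \<longrightarrow>
        v \<oplus>\<^bsub>total_space M\<^esub> w \<in> carrier (total_space M)"
    proof (intro allI impI, elim conjE)
      fix v w assume v: "v \<in> carrier (total_space M)" and w: "w \<in> carrier (total_space M)"
      have "{l. v l \<oplus>\<^bsub>space M l\<^esub> w l \<noteq> \<zero>\<^bsub>space M l\<^esub>}
          \<subseteq> {l. v l \<noteq> \<zero>\<^bsub>space M l\<^esub>} \<union> {l. w l \<noteq> \<zero>\<^bsub>space M l\<^esub>}"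
        by auto
      with v w show "v \<oplus>\<^bsub>total_space M\<^esub> w \<in> carrier (total_space M)"
        by (simp add: finite_subset)
    qed
    show "\<forall>c v. c \<in> carrier K \<and> v \<in> carrier (total_space M) \<longrightarrow>
        c \<odot>\<^bsub>total_space M\<^esub> v \<in> carrier (total_space M)"
    proof (intro allI impI, elim conjE)
      fix c v assume c: "c \<in> carrier K" and v: "v \<in> carrier (total_space M)"
      have "{l. c \<odot>\<^bsub>space M l\<^esub> v l \<noteq> \<zero>\<^bsub>space M l\<^esub>} \<subseteq> {l. v l \<noteq> \<zero>\<^bsub>space M l\<^esub>}"
        using c by auto
      with c v show "c \<odot>\<^bsub>total_space M\<^esub> v \<in> carrier (total_space M)"
        by (simp add: finite_subset)
    qed
    show "\<forall>v\<in>carrier (total_space M). \<exists>w\<in>carrier (total_space M).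
        v \<oplus>\<^bsub>total_space M\<^esub> w = \<zero>\<^bsub>total_space M\<^esub>"
    proof
      fix v assume v: "v \<in> carrier (total_space M)"
      have "{l. \<ominus>\<^bsub>space M l\<^esub> v l \<noteq> \<zero>\<^bsub>space M l\<^esub>} \<subseteq> {l. v l \<noteq> \<zero>\<^bsub>space M l\<^esub>}"
        by auto
      with v have "(\<lambda>l. \<ominus>\<^bsub>space M l\<^esub> v l) \<in> carrier (total_space M)"
        by (simp add: finite_subset)
      moreover have "v \<oplus>\<^bsub>total_space M\<^esub> (\<lambda>l. \<ominus>\<^bsub>space M l\<^esub> v l) = \<zero>\<^bsub>total_space M\<^esub>"
        using v by (simp add: V.M.r_neg)
      ultimately show "\<exists>w\<in>carrier (total_space M). v \<oplus>\<^bsub>total_space M\<^esub> w = \<zero>\<^bsub>total_space M\<^esub>"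
        by blast
    qed
    show "\<forall>v w. v \<in> carrier (total_space M) \<and> w \<in> carrier (total_space M) \<longrightarrow>
        v \<oplus>\<^bsub>total_space M\<^esub> w = w \<oplus>\<^bsub>total_space M\<^esub> v"
      by (simp add: V.M.a_comm)
  qed (simp_all add: V.M.a_assoc V.smult_assoc1 V.smult_l_distr V.smult_r_distr)
qed

text \<open>A functor whose value at \<open>l\<close> has coordinate \<open>0\<close> and whose value at \<open>m\<close> has coordinates
  \<open>1, \<dots>, n\<close>, the distinguished morphism \<open>l \<rightarrow> m\<close> being given by the column \<open>t\<close>.\<close>

definition coord_at :: "nat \<Rightarrow> weight \<Rightarrow> weight \<Rightarrow> weight \<Rightarrow> nat \<Rightarrow> bool" where
  "coord_at n l m k i \<longleftrightarrow> (if i = 0 then k = l else i \<le> n \<and> k = m)"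

definition column_rep ::
    "('a, 'r) ring_scheme \<Rightarrow> nat \<Rightarrow> weight \<Rightarrow> weight \<Rightarrow> (nat \<Rightarrow> 'a) \<Rightarrow> ('a, nat \<Rightarrow> 'a) weight_rep" where
  "column_rep K n l m t =
     \<lparr>space = (\<lambda>k. coord_space K (coord_at n l m k)),
      act = (\<lambda>j k f v i.
        (if coord_at n l m j i \<and> coord_at n l m k i then f \<otimes>\<^bsub>K\<^esub> v i else \<zero>\<^bsub>K\<^esub>) \<oplus>\<^bsub>K\<^esub>
        (if j = l \<and> k = m then t i \<otimes>\<^bsub>K\<^esub> (f \<otimes>\<^bsub>K\<^esub> v 0) else \<zero>\<^bsub>K\<^esub>))\<rparr>"

text \<open>One condition covers both reasons for which the functor laws force \<open>t = 0\<close>: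
  for \<open>l = m\<close> the identity would not act as the identity, and for a link through a
  third weight the composite would be zero. The range of \<open>i\<close> keeps the image inside the
  coordinates present at \<open>m\<close>.\<close>

definition column :: "('a, 'r) ring_scheme \<Rightarrow> nat \<Rightarrow> weight \<Rightarrow> weight \<Rightarrow> (nat \<Rightarrow> 'a) \<Rightarrow> bool" where
  "column K n l m t \<longleftrightarrow>
     (\<forall>i. t i \<in> carrier K \<and> (t i = \<zero>\<^bsub>K\<^esub> \<or> irreducible_link l m \<and> i \<noteq> 0 \<and> i \<le> n))"

context field
begin

text \<open>All laws but composition hold coordinate by coordinate. For composition through a weight
  \<open>j\<close> different from both ends of the route, the right-hand side is zero, so
  \<open>g f\<close> has to vanish wherever the left-hand side could be non-zero: on loops, and on
  the route from \<open>l\<close> to \<open>m\<close>.\<close>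

lemma linear_functor_column_rep:
  assumes t: "column R n l m t"
  shows "linear_functor R (column_rep R n l m t)"
proof -
  let ?C = "coord_at n l m" and ?M = "column_rep R n l m t"
  have sp: "space ?M k = coord_space R (?C k)" for k by (simp add: column_rep_def)
  have tK [simp]: "t i \<in> carrier R" for i using t by (simp add: column_def)
  have t0: "t i = \<zero>" if "\<not> (irreducible_link l m \<and> i \<noteq> 0 \<and> i \<le> n)" for i
    using t that by (auto simp: column_def)
  have act: "act ?M j k f v =
      (\<lambda>i. (if ?C j i \<and> ?C k i then f \<otimes> v i else \<zero>) \<oplus>
        (if j = l \<and> k = m then t i \<otimes> (f \<otimes> v 0) else \<zero>))" for j k f v
    by (simp add: column_rep_def)
  have vK: "v i \<in> carrier R" "\<not> ?C k i \<Longrightarrow> v i = \<zero>" if "v \<in> carrier (space ?M k)" for v k i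
    using that by (auto simp: sp)
  have closed: "act ?M j k f v \<in> carrier (space ?M k)"
    if "f \<in> carrier R" "v \<in> carrier (space ?M j)" for j k f v
  proof -
    have "act ?M j k f v i = \<zero>" if i: "\<not> ?C k i" for i
    proof -
      have "k = m \<Longrightarrow> t i = \<zero>"
        using i by (intro t0) (auto simp: coord_at_def split: if_splits)
      with i vK(1)[OF \<open>v \<in> _\<close>, of 0] \<open>f \<in> _\<close> show ?thesis by (auto simp: act)
    qed
    moreover have "act ?M j k f v i \<in> carrier R" for i
      using that(1) vK(1)[OF that(2)] by (simp add: act)
    ultimately show ?thesis
      unfolding sp coord_space_simps by blast
  qed
  have vs: "vectorspace R (space ?M k)" for k
    by (simp add: sp vectorspace_coord_space)
  have lin: "linear_map R (space ?M j) (space ?M k) (act ?M j k f)" if f: "f \<in> carrier R" for j k f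
  proof (rule linear_mapI[OF vs vs])
    show "act ?M j k f v \<in> carrier (space ?M k)" if "v \<in> carrier (space ?M j)" for v
      using f that by (rule closed)
    show "act ?M j k f (v \<oplus>\<^bsub>space ?M j\<^esub> w) = act ?M j k f v \<oplus>\<^bsub>space ?M k\<^esub> act ?M j k f w"
      if "v \<in> carrier (space ?M j)" "w \<in> carrier (space ?M j)" for v w
      using f that(1)[THEN vK(1)] that(2)[THEN vK(1)]
      by (auto simp: sp act r_distr a_ac fun_eq_iff)
    show "act ?M j k f (c \<odot>\<^bsub>space ?M j\<^esub> v) = c \<odot>\<^bsub>space ?M k\<^esub> act ?M j k f v"
      if "c \<in> carrier R" "v \<in> carrier (space ?M j)" for c v
      using f that(1) that(2)[THEN vK(1)]
      by (auto simp: sp act r_distr m_ac fun_eq_iff)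
  qed
  have add: "act ?M j k (f \<oplus> g) v = act ?M j k f v \<oplus>\<^bsub>space ?M k\<^esub> act ?M j k g v"
    if "f \<in> carrier R" "g \<in> carrier R" "v \<in> carrier (space ?M j)" for f g j k v
    using that(1,2) that(3)[THEN vK(1)] by (auto simp: sp act r_distr l_distr a_ac fun_eq_iff)
  have smult: "act ?M j k (c \<otimes> f) v = c \<odot>\<^bsub>space ?M k\<^esub> act ?M j k f v"
    if "c \<in> carrier R" "f \<in> carrier R" "v \<in> carrier (space ?M j)" for c f j k v
    using that(1,2) that(3)[THEN vK(1)] by (auto simp: sp act r_distr m_ac fun_eq_iff)
  have one: "act ?M j j \<one> v = v" if "v \<in> carrier (space ?M j)" for j v
  proof
    fix i show "act ?M j j \<one> v i = v i"
      using that[THEN vK(1)] that[THEN vK(2)] t0[of i] by (auto simp: act irreducible_link_def)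
  qed
  have comp: "act ?M i k (weight_comp R i k g f) v = act ?M j k g (act ?M i j f v)"
    if f: "f \<in> carrier (weight_hom R i j)" and g: "g \<in> carrier (weight_hom R j k)"
      and v: "v \<in> carrier (space ?M i)" for i j k f g v
  proof
    fix p
    note [simp] = v[THEN vK(1)]
    have fg [simp]: "f \<in> carrier R" "g \<in> carrier R" using f g by auto
    have gf0: "g \<otimes> f = \<zero>" if "\<not> (linked i j \<and> linked j k)"
      using f g that by auto
    have *: "g \<otimes> (f \<otimes> x) = g \<otimes> f \<otimes> x" "t p \<otimes> (g \<otimes> (f \<otimes> x)) = t p \<otimes> (g \<otimes> f \<otimes> x)"
      "g \<otimes> (t p \<otimes> (f \<otimes> x)) = t p \<otimes> (g \<otimes> f \<otimes> x)" if "x \<in> carrier R" for x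
      using that by (simp_all add: m_ac)
    \<comment> \<open>On a loop the composite would be a multiple of the identity, while the detour
      through \<open>j\<close> acts as zero. Antisymmetry says that one of the two Hom spaces is
      zero.\<close>
    have loop: "g \<otimes> f = \<zero>" if "i = k" "j \<noteq> k"
      using that gf0 linked_antisym by blast
    show "act ?M i k (weight_comp R i k g f) v p = act ?M j k g (act ?M i j f v) p"
    proof (cases "irreducible_link l m \<and> p \<noteq> 0 \<and> p \<le> n")
      case True
      then have lm: "l \<noteq> m" "linked l m"
        and mid: "linked l j \<Longrightarrow> linked j m \<Longrightarrow> j = l \<or> j = m"
        by (auto simp: irreducible_link_def)
      show ?thesis
      proof (cases "i = l \<and> k = m")
        case il: True
        \<comment> \<open>This is where irreducibility enters: a third weight \<open>j\<close>
          cannot be linked on both sides, so one of the coordinates \<open>f\<close>,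
          \<open>g\<close> is zero.\<close>
        then have "j \<noteq> l \<Longrightarrow> j \<noteq> m \<Longrightarrow> g \<otimes> f = \<zero>"
          using gf0 mid by blast
        with il True lm * t0[of 0] show ?thesis
          by (auto simp: act coord_at_def weight_comp_def)
      next
        case False
        with True lm loop * t0[of 0] show ?thesis
          by (auto simp: act coord_at_def weight_comp_def)
      qed
    next
      case False
      then have "t p = \<zero>" by (rule t0)
      with loop * vK(2)[OF v, of p] show ?thesis
        by (auto simp: act coord_at_def weight_comp_def)
    qed
  qed
  show ?thesis
    unfolding linear_functor_def weight_hom_simps(2,3)
    by (intro conjI allI ballI, rule vs, rule lin, simp, rule add, simp_all add: smult one comp)
qed

lemma finite_functor_column_rep:
  assumes "column R n l m t"
  shows "finite_functor R (column_rep R n l m t)"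
proof -
  let ?M = "column_rep R n l m t"
  let ?T = "total_space ?M"
  have sp: "space ?M k = coord_space R (coord_at n l m k)" for k by (simp add: column_rep_def)
  interpret T: vectorspace R ?T
    by (rule vectorspace_total_space) (simp add: sp vectorspace_coord_space)
  \<comment> \<open>Each coordinate lives at exactly one weight, so the total space has the
    coordinates \<open>0\<close> to \<open>n\<close> in all, and \<open>e i\<close> is the unit
    vector for coordinate \<open>i\<close> placed at \<open>w i\<close>.\<close>
  define w where "w i = (if i = 0 then l else m)" for i :: nat
  have coord_at: "coord_at n l m k i \<longleftrightarrow> i \<le> n \<and> k = w i" for k i
    by (auto simp: coord_at_def w_def)
  define e where "e i = (\<lambda>k j. if j = i \<and> k = w i then \<one> else \<zero>)" for i
  let ?E = "e ` {..n}"
  have e: "e i \<in> carrier ?T" if "i \<le> n" for i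
  proof -
    have "{k. e i k \<noteq> (\<lambda>j. \<zero>)} \<subseteq> {w i}" by (auto simp: e_def)
    then have "finite {k. e i k \<noteq> (\<lambda>j. \<zero>)}" by (rule finite_subset) simp
    with that show ?thesis by (auto simp: sp e_def coord_at)
  qed
  then have E: "?E \<subseteq> carrier ?T" by auto
  interpret S: submodule R "T.span ?E" ?T
    by (rule T.span_is_submodule[OF E])
  have "v \<in> T.span ?E" if v: "v \<in> carrier ?T" for v
  proof -
    have vK: "v k i \<in> carrier R" "\<not> coord_at n l m k i \<Longrightarrow> v k i = \<zero>" for k i
      using v by (auto simp: sp)
    \<comment> \<open>Truncations of \<open>v\<close> are built up one coordinate at a time. The
      last index is \<open>n\<close>, so the truncation at \<open>Suc n\<close> is all of
      \<open>v\<close>.\<close>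
    have "(\<lambda>k i. if i < j then v k i else \<zero>) \<in> T.span ?E" if "j \<le> Suc n" for j
      using that
    proof (induction j)
      case 0
      then show ?case using S.zero_closed by (simp add: sp)
    next
      case (Suc j)
      have "e j \<in> T.span ?E"
        using T.in_own_span[OF E] Suc.prems by auto
      with Suc vK(1) have "(\<lambda>k i. if i < j then v k i else \<zero>) \<oplus>\<^bsub>?T\<^esub> (v (w j) j \<odot>\<^bsub>?T\<^esub> e j) \<in> T.span ?E"
        by (intro S.m_closed S.smult_closed) auto
      also have "(\<lambda>k i. if i < j then v k i else \<zero>) \<oplus>\<^bsub>?T\<^esub> (v (w j) j \<odot>\<^bsub>?T\<^esub> e j)
          = (\<lambda>k i. if i < Suc j then v k i else \<zero>)"
        using vK(1) vK(2)[unfolded coord_at] by (auto simp: sp e_def fun_eq_iff less_Suc_eq)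
      finally show ?case .
    qed
    from this[of "Suc n"] have "(\<lambda>k i. if i < Suc n then v k i else \<zero>) \<in> T.span ?E" by simp
    also have "(\<lambda>k i. if i < Suc n then v k i else \<zero>) = v"
      using vK(2)[unfolded coord_at] by (auto simp: fun_eq_iff)
    finally show ?thesis .
  qed
  with S.subset have "T.span ?E = carrier ?T" by auto
  with E have "T.fin_dim"
    unfolding T.fin_dim_def by (intro exI[of _ ?E]) auto
  then show ?thesis
    by (simp add: finite_functor_def linear_functor_column_rep[OF assms])
qed

end

section \<open>Extensions with a given cocycle\<close>

lemma simple_simps [simp]:
  "space (simple K l) k = line K (k = l)"
  "act (simple K l) j k f x = (if j = l \<and> k = l then f \<otimes>\<^bsub>K\<^esub> x else \<zero>\<^bsub>K\<^esub>)"
  by (simp_all add: simple_def)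

lemma functor_sum_simps [simp]:
  "space (functor_sum M N) k = direct_sum (space M k) (space N k)"
  "act (functor_sum M N) j k f = map_prod (act M j k f) (act N j k f)"
  by (simp_all add: functor_sum_def)

lemma space_column_rep [simp]: "space (column_rep K n l m t) k = coord_space K (coord_at n l m k)"
  by (simp add: column_rep_def)

lemma coord_spaceD:
  assumes "v \<in> carrier (coord_space K Q)"
  shows "v i \<in> carrier K" and "\<not> Q i \<Longrightarrow> v i = \<zero>\<^bsub>K\<^esub>"
  using assms by auto

text \<open>The normal form of an extension: coordinate 0 carries the quotient and coordinate 1 the
  subobject. They stay separate even for \<open>l = m\<close>, when both live at the same
  weight.\<close>

definition cocycle_ext ::
    "('a, 'r) ring_scheme \<Rightarrow> weight \<Rightarrow> weight \<Rightarrow> 'a \<Rightarrow> ('a, 'a, 'a) std_ext" where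
  "cocycle_ext K l m t =
     \<lparr>middle = column_rep K 1 l m (\<lambda>i. if i = 1 then t else \<zero>\<^bsub>K\<^esub>),
      incl = (\<lambda>k a i. if i = 1 then a else \<zero>\<^bsub>K\<^esub>), proj = (\<lambda>k v. v 0)\<rparr>"

text \<open>The pullback, along the diagonal, of the direct sum of two normal forms: coordinate 0 is
  the shared quotient, coordinates 1 and 2 carry the two copies of the subobject. It serves as the
  intermediate \<open>F\<close> in \<open>baer_sum\<close>.\<close>

definition cocycle_ext2 ::
    "('a, 'r) ring_scheme \<Rightarrow> weight \<Rightarrow> weight \<Rightarrow> 'a \<Rightarrow> 'a \<Rightarrow> ('a, 'a \<times> 'a, 'a) std_ext" where
  "cocycle_ext2 K l m t u =
     \<lparr>middle = column_rep K 2 l m (\<lambda>i. if i = 1 then t else if i = 2 then u else \<zero>\<^bsub>K\<^esub>),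
      incl = (\<lambda>k a i. if i = 1 then fst a else if i = 2 then snd a else \<zero>\<^bsub>K\<^esub>), proj = (\<lambda>k v. v 0)\<rparr>"

context field
begin

text \<open>The part common to one and two copies of the subobject: in both, the quotient is read
  off at coordinate 0 and the kernel consists of the vectors vanishing there.\<close>

lemma extension_columnI:
  assumes t: "column R n l m t" and nat: "nat_trans R A (column_rep R n l m t) \<iota>"
    and inj: "\<And>k. inj_on (\<iota> k) (carrier (space A k))"
    and img: "\<And>k v. v \<in> carrier (coord_space R (coord_at n l m k)) \<Longrightarrow> v 0 = \<zero> \<Longrightarrow>
      v \<in> \<iota> k ` carrier (space A k)"
    and zero: "\<And>k a. \<iota> k a 0 = \<zero>"
  shows "extension R A (simple R l) \<lparr>middle = column_rep R n l m t, incl = \<iota>, proj = (\<lambda>k v. v 0)\<rparr>"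
  unfolding extension_def ext_data.simps
proof (intro conjI allI)
  show "finite_functor R (column_rep R n l m t)"
    by (rule finite_functor_column_rep[OF t])
  show "nat_trans R A (column_rep R n l m t) \<iota>" by (rule nat)
  \<comment> \<open>Otherwise the column would feed back into coordinate 0 and the projection would
    fail to be natural.\<close>
  have "t 0 = \<zero>" using t by (auto simp: column_def)
  have closed: "v 0 \<in> carrier (space (simple R l) k)"
    if "v \<in> carrier (space (column_rep R n l m t) k)" for k v
    using coord_spaceD[OF that[unfolded space_column_rep], of 0] by (auto simp: coord_at_def)
  show "nat_trans R (column_rep R n l m t) (simple R l) (\<lambda>k v. v 0)"
    using \<open>t 0 = \<zero>\<close>
    by (intro nat_transI linear_mapI closed)
       (auto simp: vectorspace_coord_space vectorspace_line column_rep_def coord_at_def)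
  fix k
  show "inj_on (\<iota> k) (carrier (space A k))" by (rule inj)
  show "\<iota> k ` carrier (space A k)
      = {v \<in> carrier (space (column_rep R n l m t) k). v 0 = \<zero>\<^bsub>space (simple R l) k\<^esub>}"
    using img[of _ k] nat_transD(2)[OF nat, of _ k] zero by auto
  show "(\<lambda>v. v 0) ` carrier (space (column_rep R n l m t) k) = carrier (space (simple R l) k)"
  proof (intro equalityI subsetI)
    fix x assume "x \<in> carrier (space (simple R l) k)"
    then show "x \<in> (\<lambda>v. v 0) ` carrier (space (column_rep R n l m t) k)"
      by (intro image_eqI[of _ _ "\<lambda>i. if i = 0 then x else \<zero>"]) (auto simp: coord_at_def)
  qed (use closed in blast)
qed

lemma column1: "t \<in> carrier (line R (irreducible_link l m)) \<Longrightarrow> column R 1 l m (\<lambda>i. if i = 1 then t else \<zero>)"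
  by (auto simp: column_def)

lemma column2:
  "t \<in> carrier (line R (irreducible_link l m)) \<Longrightarrow> u \<in> carrier (line R (irreducible_link l m)) \<Longrightarrow>
     column R 2 l m (\<lambda>i. if i = 1 then t else if i = 2 then u else \<zero>)"
  by (auto simp: column_def)

lemma extension_cocycle_ext:
  assumes t: "t \<in> carrier (line R (irreducible_link l m))"
  shows "extension R (simple R m) (simple R l) (cocycle_ext R l m t)"
  unfolding cocycle_ext_def
proof (rule extension_columnI)
  show "column R 1 l m (\<lambda>i. if i = 1 then t else \<zero>)" by (rule column1[OF t])
  show "nat_trans R (simple R m) (column_rep R 1 l m (\<lambda>i. if i = 1 then t else \<zero>))
      (\<lambda>k a i. if i = 1 then a else \<zero>)"
    using t by (intro nat_transI linear_mapI)
       (auto simp: vectorspace_coord_space vectorspace_line column_rep_def coord_at_def fun_eq_iff)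
  show "inj_on (\<lambda>a i. if i = 1 then a else \<zero>) (carrier (space (simple R m) k))" for k
    by (auto simp: inj_on_def fun_eq_iff)
  show "v \<in> (\<lambda>a i. if i = 1 then a else \<zero>) ` carrier (space (simple R m) k)"
    if "v \<in> carrier (coord_space R (coord_at 1 l m k))" "v 0 = \<zero>" for k v
  proof (rule image_eqI)
    show "v = (\<lambda>i. if i = 1 then v 1 else \<zero>)"
    proof
      fix i show "v i = (if i = 1 then v 1 else \<zero>)"
        using that(2) coord_spaceD[OF that(1), of i] by (cases "i = 0") (auto simp: coord_at_def)
    qed
    show "v 1 \<in> carrier (space (simple R m) k)"
      using coord_spaceD[OF that(1), of 1] by (auto simp: coord_at_def)
  qed
qed simp

lemma extension_cocycle_ext2:
  assumes t: "t \<in> carrier (line R (irreducible_link l m))" and u: "u \<in> carrier (line R (irreducible_link l m))"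
  shows "extension R (functor_sum (simple R m) (simple R m)) (simple R l) (cocycle_ext2 R l m t u)"
  unfolding cocycle_ext2_def
proof (rule extension_columnI)
  let ?\<iota> = "\<lambda>a i. if i = (1::nat) then fst a else if i = 2 then snd a else \<zero>"
  show "column R 2 l m (\<lambda>i. if i = 1 then t else if i = 2 then u else \<zero>)" by (rule column2[OF t u])
  show "nat_trans R (functor_sum (simple R m) (simple R m))
      (column_rep R 2 l m (\<lambda>i. if i = 1 then t else if i = 2 then u else \<zero>)) (\<lambda>k. ?\<iota>)"
    using t u by (intro nat_transI linear_mapI)
       (auto simp: vectorspace_coord_space vectorspace_line direct_sum_is_vs
          column_rep_def coord_at_def fun_eq_iff)
  show "inj_on ?\<iota> (carrier (space (functor_sum (simple R m) (simple R m)) k))" for k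
  proof (rule inj_onI)
    fix a b assume "?\<iota> a = ?\<iota> b"
    from fun_cong[OF this, of 1] fun_cong[OF this, of 2] show "a = b" by (simp add: prod_eq_iff)
  qed
  show "v \<in> ?\<iota> ` carrier (space (functor_sum (simple R m) (simple R m)) k)"
    if "v \<in> carrier (coord_space R (coord_at 2 l m k))" "v 0 = \<zero>" for k v
  proof (rule image_eqI)
    show "v = ?\<iota> (v 1, v 2)"
    proof
      fix i show "v i = ?\<iota> (v 1, v 2) i"
        using that(2) coord_spaceD[OF that(1), of i] by (cases "i = 0") (auto simp: coord_at_def)
    qed
    show "(v 1, v 2) \<in> carrier (space (functor_sum (simple R m) (simple R m)) k)"
      using coord_spaceD[OF that(1), of 1] coord_spaceD[OF that(1), of 2]
      by (auto simp: coord_at_def)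
  qed
qed simp

section \<open>Explicit morphisms between normal forms\<close>

lemma ext_morphism_cocycle_smult:
  assumes c: "c \<in> carrier R" and t: "t \<in> carrier (line R (irreducible_link l m))"
  shows "ext_morphism R (simple R m) (cocycle_ext R l m t) (cocycle_ext R l m (c \<otimes> t))
    (\<lambda>k a. c \<otimes> a) (\<lambda>k x. x)"
proof -
  let ?\<beta> = "\<lambda>k v i. if i = (1::nat) then c \<otimes> v 1 else v i"
  have "nat_trans R (middle (cocycle_ext R l m t)) (middle (cocycle_ext R l m (c \<otimes> t))) ?\<beta>"
  proof (intro nat_transI linear_mapI)
    fix k v assume "v \<in> carrier (space (middle (cocycle_ext R l m t)) k)"
    with c show "?\<beta> k v \<in> carrier (space (middle (cocycle_ext R l m (c \<otimes> t))) k)"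
      by (auto simp: cocycle_ext_def dest: spec[of _ "1::nat"])
  qed (use c t in \<open>auto simp: cocycle_ext_def column_rep_def coord_at_def vectorspace_coord_space
      fun_eq_iff r_distr m_ac\<close>)
  then show ?thesis
    unfolding ext_morphism_def using c
    by (intro exI[of _ ?\<beta>]) (auto simp: cocycle_ext_def)
qed

lemma ext_morphism_cocycle_sum:
  assumes t: "t \<in> carrier (line R (irreducible_link l m))" and u: "u \<in> carrier (line R (irreducible_link l m))"
  shows "ext_morphism R (functor_sum (simple R m) (simple R m)) (cocycle_ext2 R l m t u)
    (ext_sum (cocycle_ext R l m t) (cocycle_ext R l m u)) (\<lambda>k a. a) (\<lambda>k c. (c, c))"
proof -
  \<comment> \<open>Coordinate 0 is doubled, as the diagonal on the quotient demands, and coordinate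
    2 becomes coordinate 1 of the second summand.\<close>
  let ?\<beta> = "\<lambda>k v. (\<lambda>i. if i \<le> (1::nat) then v i else \<zero>,
                   \<lambda>i. if i = (0::nat) then v 0 else if i = 1 then v 2 else \<zero>)"
  have "nat_trans R (middle (cocycle_ext2 R l m t u))
      (middle (ext_sum (cocycle_ext R l m t) (cocycle_ext R l m u))) ?\<beta>"
  proof (intro nat_transI linear_mapI)
    fix k v assume "v \<in> carrier (space (middle (cocycle_ext2 R l m t u)) k)"
    then have v: "v \<in> carrier (coord_space R (coord_at 2 l m k))"
      by (simp add: cocycle_ext2_def)
    show "?\<beta> k v \<in> carrier (space (middle (ext_sum (cocycle_ext R l m t) (cocycle_ext R l m u))) k)"
      using coord_spaceD[OF v, of 0] coord_spaceD[OF v, of 1] coord_spaceD[OF v, of 2]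
      by (auto simp: cocycle_ext_def ext_sum_def coord_at_def le_Suc_eq)
  qed (use t u in \<open>auto simp: cocycle_ext_def cocycle_ext2_def ext_sum_def column_rep_def coord_at_def
      vectorspace_coord_space direct_sum_is_vs fun_eq_iff le_Suc_eq\<close>)
  then show ?thesis
    unfolding ext_morphism_def
    by (intro exI[of _ ?\<beta>]) (auto simp: cocycle_ext_def cocycle_ext2_def ext_sum_def fun_eq_iff le_Suc_eq)
qed

lemma ext_morphism_cocycle_add:
  assumes t: "t \<in> carrier (line R (irreducible_link l m))" and u: "u \<in> carrier (line R (irreducible_link l m))"
  shows "ext_morphism R (functor_sum (simple R m) (simple R m)) (cocycle_ext2 R l m t u)
    (cocycle_ext R l m (t \<oplus> u)) (\<lambda>k (a, b). a \<oplus>\<^bsub>space (simple R m) k\<^esub> b) (\<lambda>k c. c)"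
proof -
  let ?\<beta> = "\<lambda>k v i. if i = (0::nat) then v 0 else if i = 1 then v 1 \<oplus> v 2 else \<zero>"
  have "nat_trans R (middle (cocycle_ext2 R l m t u)) (middle (cocycle_ext R l m (t \<oplus> u))) ?\<beta>"
  proof (intro nat_transI linear_mapI)
    fix k v assume "v \<in> carrier (space (middle (cocycle_ext2 R l m t u)) k)"
    then have v: "v \<in> carrier (coord_space R (coord_at 2 l m k))"
      by (simp add: cocycle_ext2_def)
    show "?\<beta> k v \<in> carrier (space (middle (cocycle_ext R l m (t \<oplus> u))) k)"
      using coord_spaceD[OF v, of 0] coord_spaceD[OF v, of 1] coord_spaceD[OF v, of 2]
      by (cases "k = m") (auto simp: cocycle_ext_def coord_at_def)
  qed (use t u in \<open>auto simp: cocycle_ext_def cocycle_ext2_def column_rep_def coord_at_def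
      vectorspace_coord_space fun_eq_iff l_distr r_distr a_ac\<close>)
  then show ?thesis
    unfolding ext_morphism_def
    by (intro exI[of _ ?\<beta>]) (auto simp: cocycle_ext_def cocycle_ext2_def fun_eq_iff)
qed

text \<open>With a zero column the two coordinates do not interact. This morphism and the explicit
  one in the opposite direction identify the zero of \<open>Ext1\<close>, whose representative has
  pairs as elements and so lies outside \<open>std_ext\<close>.\<close>

lemma ext_morphism_cocycle_split:
  "ext_morphism R (simple R m) (cocycle_ext R l m \<zero>) (split_ext (simple R m) (simple R l))
    (\<lambda>k a. a) (\<lambda>k c. c)"
proof -
  let ?\<beta> = "\<lambda>k v. (v (1::nat), v (0::nat))"
  have "nat_trans R (middle (cocycle_ext R l m \<zero>)) (middle (split_ext (simple R m) (simple R l))) ?\<beta>"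
  proof (intro nat_transI linear_mapI)
    fix k v assume "v \<in> carrier (space (middle (cocycle_ext R l m \<zero>)) k)"
    then have v: "v \<in> carrier (coord_space R (coord_at 1 l m k))"
      by (simp add: cocycle_ext_def)
    show "?\<beta> k v \<in> carrier (space (middle (split_ext (simple R m) (simple R l))) k)"
      using coord_spaceD[OF v, of 0] coord_spaceD[OF v, of 1]
      by (auto simp: split_ext_def coord_at_def)
  qed (auto simp: cocycle_ext_def split_ext_def column_rep_def coord_at_def
      vectorspace_coord_space vectorspace_line direct_sum_is_vs)
  then show ?thesis
    unfolding ext_morphism_def
    by (intro exI[of _ ?\<beta>]) (auto simp: cocycle_ext_def split_ext_def)
qed

lemma ext_morphism_split_cocycle:
  "ext_morphism R (simple R m) (split_ext (simple R m) (simple R l)) (cocycle_ext R l m \<zero>)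
    (\<lambda>k a. a) (\<lambda>k c. c)"
proof -
  let ?\<beta> = "\<lambda>k x i. if i = (0::nat) then snd x else if i = 1 then fst x else \<zero>"
  have "nat_trans R (middle (split_ext (simple R m) (simple R l))) (middle (cocycle_ext R l m \<zero>)) ?\<beta>"
    by (intro nat_transI linear_mapI)
       (auto simp: cocycle_ext_def split_ext_def column_rep_def coord_at_def
          vectorspace_coord_space vectorspace_line direct_sum_is_vs fun_eq_iff)
  then show ?thesis
    unfolding ext_morphism_def
    by (intro exI[of _ ?\<beta>]) (auto simp: cocycle_ext_def split_ext_def fun_eq_iff)
qed

end

section \<open>The cocycle of an extension\<close>

text \<open>Confining \<open>t\<close> to a line that is zero on reducible links makes the scalar
  unique in all cases. For \<open>l = m\<close> or unlinked weights the condition on the action is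
  void and the definition says that \<open>t = 0\<close>; on a reducible link between distinct
  weights it says that the lift is killed.\<close>

definition has_cocycle ::
    "('a, 'r) ring_scheme \<Rightarrow> weight \<Rightarrow> weight \<Rightarrow> ('a, 'a, 'v, 'a) ext_data \<Rightarrow> 'a \<Rightarrow> bool" where
  "has_cocycle K l m E t \<longleftrightarrow> t \<in> carrier (line K (irreducible_link l m)) \<and>
     (\<exists>s \<in> carrier (space (middle E) l). proj E l s = \<one>\<^bsub>K\<^esub> \<and>
        (l \<noteq> m \<longrightarrow> linked l m \<longrightarrow> act (middle E) l m \<one>\<^bsub>K\<^esub> s = incl E m t))"

locale simple_extension = field K for K (structure) +
  fixes l m :: weight and E :: "('a, 'a, 'v, 'a) ext_data"
  assumes ext: "extension K (simple K m) (simple K l) E"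
begin

lemma functor_E: "linear_functor K (middle E)"
  and incl_nat: "nat_trans K (simple K m) (middle E) (incl E)"
  and proj_nat: "nat_trans K (middle E) (simple K l) (proj E)"
  and incl_inj: "inj_on (incl E k) (carrier (line K (k = m)))"
  and incl_range: "incl E k ` carrier (line K (k = m))
    = {x \<in> carrier (space (middle E) k). proj E k x = \<zero>}"
  and proj_range: "proj E k ` carrier (space (middle E) k) = carrier (line K (k = l))"
  using ext by (auto simp: extension_def finite_functor_def)

sublocale E: vectorspace K "space (middle E) k" for k
  by (rule linear_functorD(1)[OF functor_E])

sublocale incl: linear_map K "line K (k = m)" "space (middle E) k" "incl E k" for k
  using nat_transD(1)[OF incl_nat, of k] by simp

sublocale proj: linear_map K "space (middle E) k" "line K (k = l)" "proj E k" for k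
  using nat_transD(1)[OF proj_nat, of k] by simp

lemma proj_zero_imp:
  assumes "x \<in> carrier (space (middle E) k)" "proj E k x = \<zero>"
  obtains a where "a \<in> carrier K" "k = m \<or> a = \<zero>" "x = incl E k a"
proof -
  have "x \<in> incl E k ` carrier (line K (k = m))"
    unfolding incl_range using assms by simp
  then obtain a where "x = incl E k a" "a \<in> carrier (line K (k = m))" by (rule imageE)
  then show thesis by (intro that[of a]) auto
qed

lemma incl_0: "incl E k \<zero> = \<zero>\<^bsub>space (middle E) k\<^esub>"
  using incl.f0_is_0[of k] by simp

lemma proj_in: "x \<in> carrier (space (middle E) k) \<Longrightarrow> k \<noteq> l \<Longrightarrow> proj E k x = \<zero>"
  using proj.f_im[of x k] by simp

text \<open>At a third weight both outer terms of the exact sequence are zero.\<close>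

lemma middle_trivial:
  assumes "x \<in> carrier (space (middle E) k)" "k \<noteq> l" "k \<noteq> m"
  shows "x = \<zero>\<^bsub>space (middle E) k\<^esub>"
  using proj_zero_imp[OF assms(1) proj_in[OF assms(1,2)]] assms(3) incl_0 by metis

lemma cocycle_exists: "\<exists>t. has_cocycle K l m E t"
proof -
  have "\<one> \<in> carrier (line K (l = l))" by simp
  then obtain s where s: "s \<in> carrier (space (middle E) l)" "proj E l s = \<one>"
    using proj_range[of l] by (metis imageE)
  show ?thesis
  proof (cases "l \<noteq> m \<and> linked l m")
    case False
    with s show ?thesis
      by (intro exI[of _ \<zero>]) (auto simp: has_cocycle_def)
  next
    case True
    then have f: "\<one> \<in> carrier (weight_hom K l m)" by simp
    let ?y = "act (middle E) l m \<one> s"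
    have y: "?y \<in> carrier (space (middle E) m)"
      using f s(1) by (rule linear_functorD(3)[OF functor_E])
    \<comment> \<open>The quotient is zero at \<open>m\<close>, so the image of the lift lies in the
      subobject and has a coordinate there.\<close>
    from proj_zero_imp[OF y proj_in[OF y]] True obtain t where t: "t \<in> carrier K" "?y = incl E m t"
      by metis
    have "t = \<zero>" if not_irr: "\<not> irreducible_link l m"
    proof -
      from not_irr True obtain x where x: "linked l x" "linked x m" "x \<noteq> l" "x \<noteq> m"
        by (auto simp: irreducible_link_def)
      then have fx: "\<one> \<in> carrier (weight_hom K l x)" "\<one> \<in> carrier (weight_hom K x m)" by simp_all
      interpret a: linear_map K "space (middle E) x" "space (middle E) m" "act (middle E) x m \<one>"
        using fx(2) by (rule linear_functorD(2)[OF functor_E])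
      have "?y = act (middle E) l m (weight_comp K l m \<one> \<one>) s"
        using True by (simp add: weight_comp_def)
      also have "\<dots> = act (middle E) x m \<one> (act (middle E) l x \<one> s)"
        by (rule linear_functorD(6)[OF functor_E fx s(1)])
      also have "act (middle E) l x \<one> s = \<zero>\<^bsub>space (middle E) x\<^esub>"
        using linear_functorD(3)[OF functor_E fx(1) s(1)] x(3,4) by (rule middle_trivial)
      finally have "incl E m t = incl E m \<zero>"
        using t(2) a.f0_is_0 by (simp add: incl_0)
      then show "t = \<zero>"
        by (rule inj_onD[OF incl_inj]) (use t in auto)
    qed
    with s t show ?thesis
      by (intro exI[of _ t]) (auto simp: has_cocycle_def)
  qed
qed

text \<open>On an irreducible link the weights differ, so the subobject vanishes at
  \<open>l\<close>, \<open>proj E l\<close> has trivial kernel, and the two lifts of 1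
  coincide.\<close>

lemma cocycle_unique:
  assumes "has_cocycle K l m E t" "has_cocycle K l m E u"
  shows "t = u"
proof (cases "irreducible_link l m")
  case False
  with assms show ?thesis by (auto simp: has_cocycle_def)
next
  case True
  then have lm: "l \<noteq> m" "linked l m" by (auto simp: irreducible_link_def)
  from assms(1) lm obtain s where s: "s \<in> carrier (space (middle E) l)" "proj E l s = \<one>"
    "act (middle E) l m \<one> s = incl E m t" "t \<in> carrier K"
    by (auto simp: has_cocycle_def)
  from assms(2) lm obtain r where r: "r \<in> carrier (space (middle E) l)" "proj E l r = \<one>"
    "act (middle E) l m \<one> r = incl E m u" "u \<in> carrier K"
    by (auto simp: has_cocycle_def)
  have d: "s \<ominus>\<^bsub>space (middle E) l\<^esub> r \<in> carrier (space (middle E) l)"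
    using s r by simp
  have "proj E l (s \<ominus>\<^bsub>space (middle E) l\<^esub> r) = \<zero>"
  proof -
    \<comment> \<open>The difference of the two projections is taken with the subtraction derived
      from the additive group of \<open>line\<close>, so it has to be evaluated in that
      group.\<close>
    have L: "abelian_group (line K (l = l))"
      using vectorspace_line[of "l = l"] by (simp add: vectorspace_def module_def)
    have "\<one> \<ominus>\<^bsub>line K (l = l)\<^esub> \<one> = \<zero>\<^bsub>line K (l = l)\<^esub>"
      by (subst abelian_group.minus_other_side[OF L]) simp_all
    with s r proj.f_minus[of s l r] show ?thesis by simp
  qed
  from proj_zero_imp[OF d this] lm have "s \<ominus>\<^bsub>space (middle E) l\<^esub> r = \<zero>\<^bsub>space (middle E) l\<^esub>"
    by (metis incl_0)
  then have "s = r" using s r by simp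
  with s r have "incl E m t = incl E m u" by simp
  then show "t = u"
    by (rule inj_onD[OF incl_inj]) (use s r in auto)
qed

text \<open>Send the unit vector of coordinate 0 to the lift \<open>s\<close> and coordinate 1 into
  the subobject by \<open>incl\<close>. Since \<open>incl\<close> is natural already, naturality
  only has to be checked on \<open>s\<close>, where the action is governed by \<open>t\<close>
  alone.\<close>

lemma ext_morphism_from_cocycle:
  assumes t: "has_cocycle K l m E t"
  shows "ext_morphism K (simple K m) (cocycle_ext K l m t) E (\<lambda>k a. a) (\<lambda>k c. c)"
proof -
  from t obtain s where tK: "t \<in> carrier (line K (irreducible_link l m))"
    and s: "s \<in> carrier (space (middle E) l)" "proj E l s = \<one>"
    and act_s: "l \<noteq> m \<Longrightarrow> linked l m \<Longrightarrow> act (middle E) l m \<one> s = incl E m t"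
    by (auto simp: has_cocycle_def)
  let ?M = "column_rep K 1 l m (\<lambda>i. if i = 1 then t else \<zero>)"
  \<comment> \<open>The guard is there because \<open>s\<close> belongs to the value at
    \<open>l\<close> only; at other weights coordinate 0 is zero anyway.\<close>
  let ?\<beta> = "\<lambda>k v. incl E k (v (1::nat)) \<oplus>\<^bsub>space (middle E) k\<^esub>
    (if k = l then v (0::nat) \<odot>\<^bsub>space (middle E) k\<^esub> s else \<zero>\<^bsub>space (middle E) k\<^esub>)"
  have v1: "v 1 \<in> carrier (line K (k = m))" and v0: "v 0 \<in> carrier K" "k \<noteq> l \<Longrightarrow> v 0 = \<zero>"
    if "v \<in> carrier (coord_space K (coord_at 1 l m k))" for v k
    using coord_spaceD[OF that, of 0] coord_spaceD[OF that, of 1] by (auto simp: coord_at_def)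
  have lin: "linear_map K (space ?M k) (space (middle E) k) (?\<beta> k)" for k
  proof (rule linear_mapI)
    show "vectorspace K (space ?M k)" by (simp add: vectorspace_coord_space)
    show "vectorspace K (space (middle E) k)" by (rule E.vectorspace_axioms)
    fix v assume "v \<in> carrier (space ?M k)"
    then have v: "v \<in> carrier (coord_space K (coord_at 1 l m k))" by simp
    note i = incl.f_im[OF v1[OF v]]
    show "?\<beta> k v \<in> carrier (space (middle E) k)"
      using i v0[OF v] s(1) by auto
    show "?\<beta> k (c \<odot>\<^bsub>space ?M k\<^esub> v) = c \<odot>\<^bsub>space (middle E) k\<^esub> ?\<beta> k v" if c: "c \<in> carrier K" for c
      using i c v0[OF v] s(1) incl.f_smult[OF c v1[OF v]]
      by (auto simp: E.smult_r_distr E.smult_assoc1)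
    fix w assume "w \<in> carrier (space ?M k)"
    then have w: "w \<in> carrier (coord_space K (coord_at 1 l m k))" by simp
    show "?\<beta> k (v \<oplus>\<^bsub>space ?M k\<^esub> w) = ?\<beta> k v \<oplus>\<^bsub>space (middle E) k\<^esub> ?\<beta> k w"
      using i incl.f_im[OF v1[OF w]] v0[OF v] v0[OF w] s(1) incl.f_add[OF v1[OF v] v1[OF w]]
      by (auto simp: E.smult_l_distr E.M.a_ac)
  qed
  \<comment> \<open>The whole orbit of the lift: multiples of \<open>s\<close> at \<open>l\<close>,
    the cocycle at \<open>m\<close>, nothing elsewhere. For \<open>l = m\<close> the first branch
    wins.\<close>
  have act_ls: "act (middle E) l k f s = f \<odot>\<^bsub>space (middle E) k\<^esub>
      (if k = l then s else if k = m then incl E m t else \<zero>\<^bsub>space (middle E) k\<^esub>)"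
    if f: "f \<in> carrier (weight_hom K l k)" for k f
  proof (cases "linked l k")
    case True
    then have one: "\<one> \<in> carrier (weight_hom K l k)" by simp
    have "act (middle E) l k f s = act (middle E) l k (f \<otimes> \<one>) s"
      using f by simp
    also have "\<dots> = f \<odot>\<^bsub>space (middle E) k\<^esub> act (middle E) l k \<one> s"
      using f by (intro linear_functorD(4)[OF functor_E _ one s(1)]) simp
    also have "act (middle E) l k \<one> s =
        (if k = l then s else if k = m then incl E m t else \<zero>\<^bsub>space (middle E) k\<^esub>)"
      using linear_functorD(5)[OF functor_E s(1)] act_s True
        middle_trivial[OF linear_functorD(3)[OF functor_E one s(1)]] by auto
    finally show ?thesis .
  next
    case False
    with f have f0: "f = \<zero>" by simp
    \<comment> \<open>Homogeneity in the morphism, with scalar 0, shows that the zero morphism acts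
      as zero.\<close>
    have "act (middle E) l k \<zero> s = act (middle E) l k (\<zero> \<otimes> \<zero>) s" by simp
    also have "\<dots> = \<zero> \<odot>\<^bsub>space (middle E) k\<^esub> act (middle E) l k \<zero> s"
      using f f0 by (intro linear_functorD(4)[OF functor_E _ _ s(1)]) auto
    also have "\<dots> = \<zero>\<^bsub>space (middle E) k\<^esub>"
      using linear_functorD(3)[OF functor_E f s(1)] f0 by simp
    finally show ?thesis
      using f0 s(1) incl.f_im[of t m] tK by auto
  qed
  have "nat_trans K ?M (middle E) ?\<beta>"
  proof (rule nat_transI)
    show "linear_map K (space ?M k) (space (middle E) k) (?\<beta> k)" for k by (rule lin)
    fix j k f v assume f: "f \<in> carrier (weight_hom K j k)" and "v \<in> carrier (space ?M j)"
    then have v: "v \<in> carrier (coord_space K (coord_at 1 l m j))" by simp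
    have fK: "f \<in> carrier K" using f by simp
    interpret a: linear_map K "space (middle E) j" "space (middle E) k" "act (middle E) j k f"
      using f by (rule linear_functorD(2)[OF functor_E])
    have i: "act (middle E) j k f (incl E j (v 1)) = incl E k (if j = m \<and> k = m then f \<otimes> v 1 else \<zero>)"
      using nat_transD(3)[OF incl_nat f] v1[OF v] by simp
    have "act (middle E) j k f (?\<beta> j v) =
        act (middle E) j k f (incl E j (v 1)) \<oplus>\<^bsub>space (middle E) k\<^esub>
        (if j = l then v 0 \<odot>\<^bsub>space (middle E) k\<^esub> act (middle E) l k f s else \<zero>\<^bsub>space (middle E) k\<^esub>)"
    proof (cases "j = l")
      case True
      with s(1) a.f_smult[of "v 0" s] v0(1)[OF v]
      have "act (middle E) j k f (v 0 \<odot>\<^bsub>space (middle E) j\<^esub> s)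
          = v 0 \<odot>\<^bsub>space (middle E) k\<^esub> act (middle E) l k f s"
        by simp
      with True s(1) v0(1)[OF v] a.f_add[OF incl.f_im[OF v1[OF v]], of "v 0 \<odot>\<^bsub>space (middle E) j\<^esub> s"]
      show ?thesis by simp
    next
      case False
      then show ?thesis
        using incl.f_im[OF v1[OF v]] a.f_im by simp
    qed
    also have "\<dots> = ?\<beta> k (act ?M j k f v)"
    proof -
      consider "j \<noteq> l" | "j = l" "k = l" | "j = l" "k \<noteq> l" "k = m" | "j = l" "k \<noteq> l" "k \<noteq> m" by blast
      then show ?thesis
      proof cases
        case 1
        then show ?thesis
          unfolding i using fK v0[OF v] v1[OF v] s(1)
          by (auto simp: column_rep_def coord_at_def incl_0)
      next
        case 2
        \<comment> \<open>If \<open>l = m\<close>, the column of the normal form also acts here; it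
          is zero because a weight has no irreducible link to itself.\<close>
        then have t0: "l = m \<Longrightarrow> t = \<zero>" using tK by (auto simp: irreducible_link_def)
        have "v 0 \<odot>\<^bsub>space (middle E) k\<^esub> act (middle E) l k f s = (f \<otimes> v 0) \<odot>\<^bsub>space (middle E) k\<^esub> s"
          using act_ls[of f k] f 2 fK v0(1)[OF v] s(1) by (simp add: E.smult_assoc1[symmetric] m_comm)
        with 2 t0 show ?thesis
          unfolding i using fK v0(1)[OF v] v1[OF v]
          by (auto simp: column_rep_def coord_at_def)
      next
        case 3
        have "v 0 \<odot>\<^bsub>space (middle E) k\<^esub> act (middle E) l k f s = (f \<otimes> v 0) \<odot>\<^bsub>space (middle E) k\<^esub> incl E m t"
          using act_ls[of f k] f 3 fK v0(1)[OF v] incl.f_im[of t m] tK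
          by (simp add: E.smult_assoc1[symmetric] m_comm)
        also have "\<dots> = incl E k (t \<otimes> (f \<otimes> v 0))"
          using incl.f_smult[of "f \<otimes> v 0" t m] 3 fK v0(1)[OF v] tK by (simp add: m_comm)
        finally show ?thesis
          unfolding i using 3 fK v0(1)[OF v] v1[OF v] tK incl.f_im[of "t \<otimes> (f \<otimes> v 0)" m]
          by (auto simp: column_rep_def coord_at_def incl_0)
      next
        case 4
        then have "v 0 \<odot>\<^bsub>space (middle E) k\<^esub> act (middle E) l k f s = \<zero>\<^bsub>space (middle E) k\<^esub>"
          using act_ls[of f k] f fK v0(1)[OF v] by simp
        with 4 show ?thesis
          unfolding i by (auto simp: column_rep_def coord_at_def)
      qed
    qed
    finally show "?\<beta> k (act ?M j k f v) = act (middle E) j k f (?\<beta> j v)" ..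
  qed
  moreover have "?\<beta> k (incl (cocycle_ext K l m t) k a) = incl E k a"
    if "a \<in> carrier (space (simple K m) k)" for k a
    using that incl.f_im[of a k] s(1) by (auto simp: cocycle_ext_def)
  moreover have "proj E k (?\<beta> k v) = proj (cocycle_ext K l m t) k v"
    if "v \<in> carrier (space (middle (cocycle_ext K l m t)) k)" for k v
  proof -
    have v: "v \<in> carrier (coord_space K (coord_at 1 l m k))"
      using that by (simp add: cocycle_ext_def)
    have "incl E k (v 1) \<in> incl E k ` carrier (line K (k = m))" using v1[OF v] by blast
    then have "proj E k (incl E k (v 1)) = \<zero>" unfolding incl_range by simp
    then show ?thesis
      using incl.f_im[OF v1[OF v]] v0[OF v] s proj.f0_is_0[of k]
      by (auto simp: cocycle_ext_def)
  qed
  ultimately show ?thesis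
    unfolding ext_morphism_def by (intro exI[of _ ?\<beta>]) (auto simp: cocycle_ext_def)
qed

end

context field
begin

lemma has_cocycle_cocycle_ext:
  assumes t: "t \<in> carrier (line R (irreducible_link l m))"
  shows "has_cocycle R l m (cocycle_ext R l m t) t"
proof -
  let ?s = "\<lambda>i. if i = (0::nat) then \<one> else \<zero>"
  have "act (middle (cocycle_ext R l m t)) l m \<one> ?s = incl (cocycle_ext R l m t) m t"
    if "l \<noteq> m"
    using that t by (auto simp: cocycle_ext_def column_rep_def coord_at_def fun_eq_iff)
  then show ?thesis
    unfolding has_cocycle_def using t
    by (intro conjI bexI[of _ ?s]) (auto simp: cocycle_ext_def coord_at_def)
qed

text \<open>Push the lift forward along \<open>\<beta>\<close>:
  \<open>\<gamma> l \<one> = \<one>\<close> keeps it a lift, and naturality turns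
  \<open>incl E m t\<close> into \<open>incl E' m (\<alpha> m t)\<close>. With
  \<open>\<alpha>\<close> the identity this is invariance under equivalence, with
  \<open>\<alpha>\<close> a scalar it is the rule for pushouts.\<close>

lemma has_cocycle_morphism:
  assumes E: "extension R (simple R m) (simple R l) E"
    and mor: "ext_morphism R (simple R m) E E' \<alpha> \<gamma>"
    and \<gamma>: "\<gamma> l \<one> = \<one>" and t: "has_cocycle R l m E t"
    and \<alpha>: "\<alpha> m t \<in> carrier (line R (irreducible_link l m))"
  shows "has_cocycle R l m E' (\<alpha> m t)"
proof -
  from mor obtain \<beta> where \<beta>: "nat_trans R (middle E) (middle E') \<beta>"
    and \<beta>_incl: "\<And>k a. a \<in> carrier (space (simple R m) k) \<Longrightarrow> \<beta> k (incl E k a) = incl E' k (\<alpha> k a)"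
    and \<beta>_proj: "\<And>k x. x \<in> carrier (space (middle E) k) \<Longrightarrow> proj E' k (\<beta> k x) = \<gamma> k (proj E k x)"
    unfolding ext_morphism_def by blast
  from t obtain s where tR: "t \<in> carrier R" and s: "s \<in> carrier (space (middle E) l)" "proj E l s = \<one>"
    and act_s: "l \<noteq> m \<Longrightarrow> linked l m \<Longrightarrow> act (middle E) l m \<one> s = incl E m t"
    by (auto simp: has_cocycle_def)
  have "act (middle E') l m \<one> (\<beta> l s) = incl E' m (\<alpha> m t)" if "l \<noteq> m" "linked l m"
  proof -
    have "act (middle E') l m \<one> (\<beta> l s) = \<beta> m (act (middle E) l m \<one> s)"
      using that(2) by (intro nat_transD(3)[OF \<beta> _ s(1), symmetric]) simp
    also have "\<dots> = incl E' m (\<alpha> m t)"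
      using act_s[OF that] \<beta>_incl[of t m] tR by simp
    finally show ?thesis .
  qed
  then show ?thesis
    unfolding has_cocycle_def using \<alpha> \<gamma> s \<beta>_proj[OF s(1)] nat_transD(2)[OF \<beta> s(1)]
    by (intro conjI bexI[of _ "\<beta> l s"]) auto
qed

section \<open>Extension classes as level sets of the cocycle\<close>

definition cocycle_class :: "weight \<Rightarrow> weight \<Rightarrow> 'a \<Rightarrow> ('a, 'a, 'a) std_ext set" where
  "cocycle_class l m t =
     {E. extension R (simple R m) (simple R l) E \<and> has_cocycle R l m E t}"

lemma ext_morphism_from_cocycle_class:
  "E \<in> cocycle_class l m t \<Longrightarrow>
     ext_morphism R (simple R m) (cocycle_ext R l m t) E (\<lambda>k a. a) (\<lambda>k c. c)"
  unfolding cocycle_class_def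
  using simple_extension.ext_morphism_from_cocycle[of R l m E t]
  by (simp add: simple_extension_def simple_extension_axioms_def field_R)

lemma cocycle_unique:
  "E \<in> cocycle_class l m t \<Longrightarrow> has_cocycle R l m E u \<Longrightarrow> t = u"
  unfolding cocycle_class_def
  using simple_extension.cocycle_unique[of R l m E t u]
  by (simp add: simple_extension_def simple_extension_axioms_def field_R)

lemma cocycle_exists:
  "extension R (simple R m) (simple R l) E \<Longrightarrow> \<exists>t. has_cocycle R l m E t"
  using simple_extension.cocycle_exists[of R l m E]
  by (simp add: simple_extension_def simple_extension_axioms_def field_R)

lemma cocycle_ext_in_class:
  "t \<in> carrier (line R (irreducible_link l m)) \<Longrightarrow> cocycle_ext R l m t \<in> cocycle_class l m t"
  by (simp add: cocycle_class_def extension_cocycle_ext has_cocycle_cocycle_ext del: line_simps(1))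

lemma ext_morphism_trans_id:
  assumes "ext_morphism R A E E' \<alpha> \<gamma>" "ext_morphism R A' E' E'' (\<lambda>k a. a) (\<lambda>k c. c)"
    and "\<And>k a. a \<in> carrier (space A k) \<Longrightarrow> \<alpha> k a \<in> carrier (space A' k)"
  shows "ext_morphism R A E E'' \<alpha> \<gamma>"
  using ext_morphism_trans[OF assms] by (simp add: comp_def)

text \<open>Morphisms over the identities preserve the cocycle, and the normal form maps to every
  extension with that cocycle.\<close>

lemma ext_class_cocycle_ext:
  assumes t: "t \<in> carrier (line R (irreducible_link l m))"
  shows "ext_class R (simple R m) (simple R l) (cocycle_ext R l m t) = cocycle_class l m t"
proof (intro equalityI subsetI)
  fix E assume "E \<in> ext_class R (simple R m) (simple R l) (cocycle_ext R l m t)"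
  then show "E \<in> cocycle_class l m t"
    using has_cocycle_morphism[OF extension_cocycle_ext[OF t], of E "\<lambda>k a. a" "\<lambda>k c. c" t]
      has_cocycle_cocycle_ext[OF t] t
    by (auto simp: ext_class_def cocycle_class_def)
next
  fix E assume "E \<in> cocycle_class l m t"
  then show "E \<in> ext_class R (simple R m) (simple R l) (cocycle_ext R l m t)"
    using ext_morphism_from_cocycle_class by (auto simp: ext_class_def cocycle_class_def)
qed

lemma ext_class_eqI:
  assumes "ext_morphism R A E E' (\<lambda>k a. a) (\<lambda>k c. c)" "ext_morphism R A E' E (\<lambda>k a. a) (\<lambda>k c. c)"
  shows "ext_class R A C E = ext_class R A C E'"
  unfolding ext_class_def
  using ext_morphism_trans_id[OF assms(1)] ext_morphism_trans_id[OF assms(2)] by blast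

text \<open>The normal form maps to \<open>E\<close>, the five lemma reverses this morphism, and so
  both have the same class.\<close>

lemma ext_class_eq_cocycle_class:
  assumes "E \<in> cocycle_class l m t"
  shows "ext_class R (simple R m) (simple R l) E = cocycle_class l m t"
proof -
  have t: "t \<in> carrier (line R (irreducible_link l m))"
    and E: "extension R (simple R m) (simple R l) E"
    using assms by (simp_all add: cocycle_class_def has_cocycle_def)
  have "ext_morphism R (simple R m) (cocycle_ext R l m t) E (\<lambda>k a. a) (\<lambda>k c. c)"
    by (rule ext_morphism_from_cocycle_class[OF assms])
  moreover from this have "ext_morphism R (simple R m) E (cocycle_ext R l m t) (\<lambda>k a. a) (\<lambda>k c. c)"
    by (rule ext_morphism_sym[OF extension_cocycle_ext[OF t] E])
  ultimately show ?thesis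
    using ext_class_eqI ext_class_cocycle_ext[OF t] by blast
qed

lemma cocycle_class_inj:
  "inj_on (cocycle_class l m) (carrier (line R (irreducible_link l m)))"
proof (rule inj_onI)
  fix t u assume t: "t \<in> carrier (line R (irreducible_link l m))"
    and "cocycle_class l m t = cocycle_class l m u"
  then have "cocycle_ext R l m t \<in> cocycle_class l m u"
    using cocycle_ext_in_class[OF t] by blast
  from cocycle_unique[OF this has_cocycle_cocycle_ext[OF t]] show "t = u" by (rule sym)
qed

section \<open>The operations of \<open>Ext1\<close> in terms of the cocycle\<close>

lemma carrier_Ext1:
  "carrier (Ext1 R (simple R l) (simple R m)) =
     cocycle_class l m ` carrier (line R (irreducible_link l m))"
proof (intro equalityI subsetI)
  fix X assume "X \<in> carrier (Ext1 R (simple R l) (simple R m))"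
  then obtain E :: "('a, 'a, 'a) std_ext" where E: "extension R (simple R m) (simple R l) E"
    and X: "X = ext_class R (simple R m) (simple R l) E"
    by (auto simp: Ext1_def)
  obtain t where t: "has_cocycle R l m E t" using cocycle_exists[OF E] by blast
  with E have "E \<in> cocycle_class l m t" by (simp add: cocycle_class_def)
  from ext_class_eq_cocycle_class[OF this] X t
  show "X \<in> cocycle_class l m ` carrier (line R (irreducible_link l m))"
    by (auto simp: has_cocycle_def)
next
  fix X assume "X \<in> cocycle_class l m ` carrier (line R (irreducible_link l m))"
  then obtain t where "t \<in> carrier (line R (irreducible_link l m))" "X = cocycle_class l m t"
    by blast
  then show "X \<in> carrier (Ext1 R (simple R l) (simple R m))"
    using ext_class_cocycle_ext[of t l m] extension_cocycle_ext[of t l m]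
    by (auto simp: Ext1_def simp del: line_simps(1))
qed

lemma zero_Ext1: "\<zero>\<^bsub>Ext1 R (simple R l) (simple R m)\<^esub> = cocycle_class l m \<zero>"
  using ext_class_eqI[OF ext_morphism_split_cocycle[of m l] ext_morphism_cocycle_split[of m l],
      where C = "simple R l"] ext_class_cocycle_ext[of \<zero> l m]
  by (simp add: Ext1_def)

text \<open>Whichever representative is pushed out, the result has cocycle
  \<open>c \<otimes> t\<close>. Conversely, the normal form for \<open>t\<close> maps by scaling to
  the one for \<open>c \<otimes> t\<close>, and from there to any extension with that
  cocycle.\<close>

lemma smult_Ext1:
  assumes c: "c \<in> carrier R" and t: "t \<in> carrier (line R (irreducible_link l m))"
  shows "c \<odot>\<^bsub>Ext1 R (simple R l) (simple R m)\<^esub> cocycle_class l m t = cocycle_class l m (c \<otimes> t)"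
proof -
  have ct: "c \<otimes> t \<in> carrier (line R (irreducible_link l m))" using c t by auto
  have "c \<odot>\<^bsub>Ext1 R (simple R l) (simple R m)\<^esub> cocycle_class l m t =
    {E. extension R (simple R m) (simple R l) E \<and>
      (\<exists>E1 \<in> cocycle_class l m t. ext_morphism R (simple R m) E1 E (\<lambda>k a. c \<otimes> a) (\<lambda>k x. x))}"
    by (simp add: Ext1_def)
  also have "\<dots> = cocycle_class l m (c \<otimes> t)"
  proof (intro equalityI subsetI; clarsimp)
    fix E E1 :: "('a, 'a, 'a) std_ext" assume E: "extension R (simple R m) (simple R l) E"
      and E1: "E1 \<in> cocycle_class l m t"
      and mor: "ext_morphism R (simple R m) E1 E (\<lambda>k a. c \<otimes> a) (\<lambda>k x. x)"
    then have "has_cocycle R l m E (c \<otimes> t)"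
      using has_cocycle_morphism[OF _ mor, of l t] ct by (simp add: cocycle_class_def)
    with E show "E \<in> cocycle_class l m (c \<otimes> t)" by (simp add: cocycle_class_def)
  next
    fix E assume E: "E \<in> cocycle_class l m (c \<otimes> t)"
    have "ext_morphism R (simple R m) (cocycle_ext R l m t) E (\<lambda>k a. c \<otimes> a) (\<lambda>k x. x)"
      by (rule ext_morphism_trans_id[OF ext_morphism_cocycle_smult[OF c t]
            ext_morphism_from_cocycle_class[OF E]]) (use c in auto)
    with E cocycle_ext_in_class[OF t]
    show "extension R (simple R m) (simple R l) E \<and> (\<exists>E1\<in>cocycle_class l m t.
        ext_morphism R (simple R m) E1 E (\<lambda>k a. c \<otimes> a) (\<lambda>k x. x))"
      by (auto simp: cocycle_class_def)
  qed
  finally show ?thesis .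
qed

text \<open>Lift 1 to the intermediate extension \<open>F\<close>. The distinguished morphism sends
  the lift to a pair \<open>(a, b)\<close> in the doubled subobject. The morphism to the direct sum
  reads \<open>a\<close> and \<open>b\<close> as cocycles of \<open>E1\<close> and
  \<open>E2\<close>; the morphism to \<open>E\<close> reads their sum as a cocycle of
  \<open>E\<close>.\<close>

lemma has_cocycle_baer_sum:
  assumes irr: "irreducible_link l m"
    and E1: "E1 \<in> cocycle_class l m t" and E2: "E2 \<in> cocycle_class l m u"
    and baer: "baer_sum R (simple R m) (simple R l) E1 E2 E"
  shows "has_cocycle R l m E (t \<oplus> u)"
proof -
  let ?A = "functor_sum (simple R m) (simple R m)"
  from irr have lm: "l \<noteq> m" "linked l m" by (auto simp: irreducible_link_def)
  then have one: "\<one> \<in> carrier (weight_hom R l m)" by simp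
  from baer obtain F :: "('a, 'a \<times> 'a, 'a) std_ext" where F: "extension R ?A (simple R l) F"
    and mor1: "ext_morphism R ?A F (ext_sum E1 E2) (\<lambda>k a. a) (\<lambda>k c. (c, c))"
    and mor2: "ext_morphism R ?A F E (\<lambda>k (a, b). a \<oplus>\<^bsub>space (simple R m) k\<^esub> b) (\<lambda>k c. c)"
    unfolding baer_sum_def by blast
  from F have F_fun: "linear_functor R (middle F)" and F_proj: "nat_trans R (middle F) (simple R l) (proj F)"
    and F_ker: "\<And>k. incl F k ` carrier (space ?A k) =
      {x \<in> carrier (space (middle F) k). proj F k x = \<zero>\<^bsub>space (simple R l) k\<^esub>}"
    and F_surj: "\<And>k. proj F k ` carrier (space (middle F) k) = carrier (space (simple R l) k)"
    unfolding extension_def finite_functor_def by blast+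
  have "\<one> \<in> proj F l ` carrier (space (middle F) l)"
    unfolding F_surj by simp
  then obtain x where x: "x \<in> carrier (space (middle F) l)" "proj F l x = \<one>" by auto
  let ?y = "act (middle F) l m \<one> x"
  have y: "?y \<in> carrier (space (middle F) m)"
    using one x(1) by (rule linear_functorD(3)[OF F_fun])
  with nat_transD(2)[OF F_proj y] lm have "?y \<in> incl F m ` carrier (space ?A m)"
    unfolding F_ker by simp
  then obtain a b where ab: "a \<in> carrier R" "b \<in> carrier R" "?y = incl F m (a, b)"
    by auto
  from mor1 obtain \<beta> where \<beta>: "nat_trans R (middle F) (middle (ext_sum E1 E2)) \<beta>"
    "\<And>k a. a \<in> carrier (space ?A k) \<Longrightarrow> \<beta> k (incl F k a) = incl (ext_sum E1 E2) k a"
    "\<And>k x. x \<in> carrier (space (middle F) k) \<Longrightarrow> proj (ext_sum E1 E2) k (\<beta> k x) = (proj F k x, proj F k x)"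
    unfolding ext_morphism_def by blast
  obtain x1 x2 where x12: "\<beta> l x = (x1, x2)" by fastforce
  have "x1 \<in> carrier (space (middle E1) l)" "x2 \<in> carrier (space (middle E2) l)"
    using nat_transD(2)[OF \<beta>(1) x(1)] x12 by (auto simp: ext_sum_def)
  moreover have "proj E1 l x1 = \<one>" "proj E2 l x2 = \<one>"
    using \<beta>(3)[OF x(1)] x12 x(2) by (auto simp: ext_sum_def)
  moreover have "act (middle E1) l m \<one> x1 = incl E1 m a" "act (middle E2) l m \<one> x2 = incl E2 m b"
    using nat_transD(3)[OF \<beta>(1) one x(1)] x12 \<beta>(2)[of "(a, b)" m] ab by (auto simp: ext_sum_def)
  ultimately have "has_cocycle R l m E1 a" "has_cocycle R l m E2 b"
    using irr ab by (auto simp: has_cocycle_def)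
  \<comment> \<open>The components of the image of the lift are lifts for \<open>E1\<close> and
    \<open>E2\<close>, perhaps not those that witnessed \<open>t\<close> and \<open>u\<close>;
    uniqueness of the cocycle makes the scalars agree.\<close>
  with E1 E2 have tu: "t = a" "u = b" by (auto dest: cocycle_unique)
  from mor2 obtain \<beta> where \<beta>: "nat_trans R (middle F) (middle E) \<beta>"
    "\<And>k a b. (a, b) \<in> carrier (space ?A k) \<Longrightarrow>
      \<beta> k (incl F k (a, b)) = incl E k (a \<oplus>\<^bsub>space (simple R m) k\<^esub> b)"
    "\<And>k x. x \<in> carrier (space (middle F) k) \<Longrightarrow> proj E k (\<beta> k x) = proj F k x"
    unfolding ext_morphism_def by fastforce
  have "act (middle E) l m \<one> (\<beta> l x) = incl E m (a \<oplus> b)"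
    using nat_transD(3)[OF \<beta>(1) one x(1)] \<beta>(2)[of a b m] ab by simp
  then show ?thesis
    unfolding has_cocycle_def tu using irr ab x \<beta>(3)[OF x(1)] nat_transD(2)[OF \<beta>(1) x(1)]
    by (intro conjI bexI[of _ "\<beta> l x"]) auto
qed

lemma add_Ext1:
  assumes t: "t \<in> carrier (line R (irreducible_link l m))" and u: "u \<in> carrier (line R (irreducible_link l m))"
  shows "cocycle_class l m t \<oplus>\<^bsub>Ext1 R (simple R l) (simple R m)\<^esub> cocycle_class l m u =
    cocycle_class l m (t \<oplus> u)"
proof -
  have "cocycle_class l m t \<oplus>\<^bsub>Ext1 R (simple R l) (simple R m)\<^esub> cocycle_class l m u =
    {E. extension R (simple R m) (simple R l) E \<and>
      (\<exists>E1 \<in> cocycle_class l m t. \<exists>E2 \<in> cocycle_class l m u.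
        baer_sum R (simple R m) (simple R l) E1 E2 E)}"
    by (simp add: Ext1_def)
  also have "\<dots> = cocycle_class l m (t \<oplus> u)"
  proof (intro equalityI subsetI; clarsimp)
    fix E E1 E2 :: "('a, 'a, 'a) std_ext" assume E: "extension R (simple R m) (simple R l) E"
      and E12: "E1 \<in> cocycle_class l m t" "E2 \<in> cocycle_class l m u"
      and baer: "baer_sum R (simple R m) (simple R l) E1 E2 E"
    have "has_cocycle R l m E (t \<oplus> u)"
    proof (cases "irreducible_link l m")
      case True
      then show ?thesis using E12 baer by (rule has_cocycle_baer_sum)
    next
      case False
      \<comment> \<open>All cocycles are zero here, so it is enough that \<open>E\<close> has one at
        all.\<close>
      with t u cocycle_exists[OF E] show ?thesis by (auto simp: has_cocycle_def)
    qed
    with E show "E \<in> cocycle_class l m (t \<oplus> u)" by (simp add: cocycle_class_def)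
  next
    fix E assume E: "E \<in> cocycle_class l m (t \<oplus> u)"
    have "ext_morphism R (functor_sum (simple R m) (simple R m)) (cocycle_ext2 R l m t u) E
        (\<lambda>k (a, b). a \<oplus>\<^bsub>space (simple R m) k\<^esub> b) (\<lambda>k c. c)"
      by (rule ext_morphism_trans_id[OF ext_morphism_cocycle_add[OF t u]
            ext_morphism_from_cocycle_class[OF E]]) auto
    \<comment> \<open>The intermediate extension is \<open>cocycle_ext2\<close>, mapping diagonally
      to the sum of the normal forms and by addition of its last two coordinates towards
      \<open>E\<close>.\<close>
    then have "baer_sum R (simple R m) (simple R l) (cocycle_ext R l m t) (cocycle_ext R l m u) E"
      unfolding baer_sum_def
      using extension_cocycle_ext2[OF t u] ext_morphism_cocycle_sum[OF t u] by blast
    with E cocycle_ext_in_class[OF t] cocycle_ext_in_class[OF u]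
    show "extension R (simple R m) (simple R l) E \<and>
      (\<exists>E1\<in>cocycle_class l m t. \<exists>E2\<in>cocycle_class l m u.
        baer_sum R (simple R m) (simple R l) E1 E2 E)"
      by (auto simp: cocycle_class_def)
  qed
  finally show ?thesis .
qed

lemma vectorspace_Ext1: "vectorspace R (Ext1 R (simple R l) (simple R m))"
  by (rule vectorspace_transfer[OF vectorspace_line carrier_Ext1[symmetric]])
     (simp_all add: zero_Ext1 add_Ext1 smult_Ext1)

lemma linear_map_cocycle_class:
  "linear_map R (line R (irreducible_link l m)) (Ext1 R (simple R l) (simple R m)) (cocycle_class l m)"
  by (rule linear_mapI[OF vectorspace_line vectorspace_Ext1])
     (simp_all add: carrier_Ext1 add_Ext1 smult_Ext1)

lemma line_one_dim:
  "vectorspace.fin_dim R (line R True)" "vectorspace.dim R (line R True) = 1"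
proof -
  interpret V: vectorspace R "line R True" by (rule vectorspace_line)
  have one: "\<one> \<in> V.span {\<one>}" by (rule subsetD[OF V.in_own_span]) auto
  interpret S: submodule R "V.span {\<one>}" "line R True"
    by (rule V.span_is_submodule) simp
  have "x \<in> V.span {\<one>}" if "x \<in> carrier R" for x
    using S.smult_closed[OF that one] that by simp
  then have gen: "V.span {\<one>} = carrier (line R True)"
    using S.subset by auto
  then show "V.fin_dim" unfolding V.fin_dim_def by (intro exI[of _ "{\<one>}"]) auto
  show "V.dim = 1" using gen by (rule V.dim1I) simp_all
qed

end

theorem corollary6p3:
  fixes K :: "('a, 'r) ring_scheme" and l m :: weight
  assumes "field K"
  shows "vectorspace K (Ext1 K (simple K l) (simple K m)) \<and>
    ((\<exists>f. basic K l m f) \<longrightarrow>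
       vectorspace.fin_dim K (Ext1 K (simple K l) (simple K m)) \<and>
       vectorspace.dim K (Ext1 K (simple K l) (simple K m)) = 1) \<and>
    (\<not> (\<exists>f. basic K l m f) \<longrightarrow>
       carrier (Ext1 K (simple K l) (simple K m)) = {\<zero>\<^bsub>Ext1 K (simple K l) (simple K m)\<^esub>}) \<and>
    ((\<exists>f. basic K l m f) \<longleftrightarrow>
       m = l @ [Black, White] \<or>
       l = m @ [White, Black] \<or>
       (m = l @ [White] \<and> \<not> suffix [Black] l) \<or>
       (l = m @ [Black] \<and> \<not> suffix [White] m))"
proof -
  interpret field K by fact
  interpret h: linear_map K "line K (irreducible_link l m)" "Ext1 K (simple K l) (simple K m)"
      "cocycle_class l m"
    by (rule linear_map_cocycle_class)
  \<comment> \<open>On an irreducible link \<open>cocycle_class\<close> is a linear bijection from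
    the field itself, so finiteness and dimension carry over.\<close>
  have "vectorspace.fin_dim K (Ext1 K (simple K l) (simple K m))"
    and "vectorspace.dim K (Ext1 K (simple K l) (simple K m)) = 1" if "irreducible_link l m"
    using that line_one_dim h.surj_fin_dim[OF _ carrier_Ext1[symmetric]]
      h.dim_eq[OF _ cocycle_class_inj carrier_Ext1[symmetric]] by simp_all
  moreover have "carrier (Ext1 K (simple K l) (simple K m)) = {\<zero>\<^bsub>Ext1 K (simple K l) (simple K m)\<^esub>}"
    if "\<not> irreducible_link l m"
  proof -
    have "carrier (line K (irreducible_link l m)) = {\<zero>\<^bsub>K\<^esub>}" using that by auto
    then show ?thesis by (simp add: carrier_Ext1 zero_Ext1)
  qed
  moreover have "irreducible_link l m \<longleftrightarrow> m = l @ [Black, White] \<or> l = m @ [White, Black] \<or>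
       (m = l @ [White] \<and> \<not> suffix [Black] l) \<or> (l = m @ [Black] \<and> \<not> suffix [White] m)"
    by (auto simp: irreducible_link_iff_elementary elementary_White_iff elementary_Black_iff)
  ultimately show ?thesis
    unfolding basic_iff_irreducible_link using vectorspace_Ext1 by blast
qed

end
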